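(* Consider the diffusion operator and its preconditioning operator with the same boundary conditions along the whole of $\partial\Omega$, which are either Neumann or periodic, and let $\mathsf A,\widetilde{\mathsf A}\in\mathbb R^{N\times N}$ be the corresponding finite element stiffness matrices defined in the context; both are singular and share the same one-dimensional null space. Let $\lambda_1=0$ and let $\lambda_2\le\dots\le\lambda_N$ be the (nonzero) eigenvalues of $\widetilde{\mathsf A}^{-1}\mathsf A$, where $\mathsf A$ and $\widetilde{\mathsf A}$ are considered restricted to the subspace of $\mathbb R^N$ orthogonal to the null space of $\mathsf A$. Let $\lambda_k^{\rm L},\lambda_k^{\rm U}$, $k=1,\dots,N$, be the patch-wise bounds defined in the context and let $r,s:\{1,\dots,N\}\to\{1,\dots,N\}$ be bijections with $\lambda^{\rm L}_{r(1)}\le\dots\le\lambda^{\rm L}_{r(N)}$ and $\lambda^{\rm U}_{s(1)}\le\dots\le\lambda^{\rm U}_{s(N)}$. Then $$\lambda^{\rm L}_{r(k-1)}\le\lambda_k\le\lambda^{\rm U}_{s(k)},\qquad k=2,\dots,N.$$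
   Context: $\Omega\subset\mathbb R^d$, $d\in\{2,3\}$, is a bounded polygonal (polyhedral) domain. In the Neumann case $V=H^1(\Omega)$; in the periodic case $\Omega$ is a rectangle (box) and $V$ is the space of functions in $H^1(\Omega)$ with equal traces on opposite sides (faces). The data $\boldsymbol A,\widetilde{\boldsymbol A}\in L^\infty(\Omega;\mathbb R^{d\times d})$ are symmetric and uniformly positive definite in $\Omega$. $\Omega$ is decomposed into finitely many elements $\mathcal E_j$, $j=1,\dots,N_e$; $\varphi_1,\dots,\varphi_N\in V$ are linearly independent continuous conforming finite element basis functions whose span contains the constant functions; $\mathcal P_k$ denotes the smallest patch (union) of elements covering the support of $\varphi_k$. The matrices have elements $$\mathsf A_{kl}=\int_\Omega\nabla\varphi_l\cdot\boldsymbol A\nabla\varphi_k\,d\boldsymbol x,\qquad \widetilde{\mathsf A}_{kl}=\int_\Omega\nabla\varphi_l\cdot\widetilde{\boldsymbol A}\nabla\varphi_k\,d\boldsymbol x.$$ For each element and each $k=1,\dots,N$ set $$\alpha_j^{\min}=\operatorname*{ess\,inf}_{\boldsymbol x\in\mathcal E_j}\lambda_{\min}\big(\widetilde{\boldsymbol A}^{-1}(\boldsymbol x)\boldsymbol A(\boldsymbol x)\big),\qquad \alpha_j^{\max}=\operatorname*{ess\,sup}_{\boldsymbol x\in\mathcal E_j}\lambda_{\max}\big(\widetilde{\boldsymbol A}^{-1}(\boldsymbol x)\boldsymbol A(\boldsymbol x)\big),$$ $$\lambda_k^{\rm L}=\min_{\mathcal E_j\subset\mathcal P_k}\alpha_j^{\min},\qquad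 \lambda_k^{\rm U}=\max_{\mathcal E_j\subset\mathcal P_k}\alpha_j^{\max},$$ where $\lambda_{\min},\lambda_{\max}$ denote the smallest and largest eigenvalue. *)

theory Defs
  imports "HOL-Analysis.Analysis" "HOL-Probability.Essential_Supremum"
begin

section \<open>Domains and decompositions into elements\<close>

text \<open>Bounded polygonal/polyhedral domain. Taking the interior of the union of the closed
  polytopes rules out domains with slits.\<close>

definition polyhedral_domain :: "(real^'d) set \<Rightarrow> bool" where
  "polyhedral_domain \<Omega> \<longleftrightarrow>
     \<Omega> \<noteq> {} \<and> connected \<Omega> \<and>
     (\<exists>F. finite F \<and> (\<forall>P\<in>F. polytope P) \<and> \<Omega> = interior (\<Union>F))"

text \<open>Elements are closed sets with non-overlapping interiors. No particular shape is required:
  simplices, quadrilaterals, non-convex cells etc. are all allowed.\<close>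

definition is_decomposition :: "(real^'d) set \<Rightarrow> nat \<Rightarrow> (nat \<Rightarrow> (real^'d) set) \<Rightarrow> bool" where
  "is_decomposition \<Omega> Ne E \<longleftrightarrow>
     (\<forall>j\<in>{1..Ne}. E j \<noteq> {} \<and> closure (interior (E j)) = E j \<and> negligible (frontier (E j))) \<and>
     (\<forall>i\<in>{1..Ne}. \<forall>j\<in>{1..Ne}. i \<noteq> j \<longrightarrow> interior (E i) \<inter> interior (E j) = {}) \<and>
     (\<Union>j\<in>{1..Ne}. E j) = closure \<Omega>"


section \<open>The space $H^1$\<close>

text \<open>Infinitely differentiable: \<open>D [i\<^sub>1, \<dots>, i\<^sub>m]\<close> is the iterated partial derivative in the
  coordinate directions \<open>i\<^sub>1, \<dots>, i\<^sub>m\<close>.\<close>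

definition smooth :: "(real^'d \<Rightarrow> real) \<Rightarrow> bool" where
  "smooth f \<longleftrightarrow>
     (\<exists>D :: 'd list \<Rightarrow> real^'d \<Rightarrow> real. D [] = f \<and>
        (\<forall>is x. GDERIV (D is) x :> (\<chi> i. D (i # is) x)))"

definition test_function :: "(real^'d) set \<Rightarrow> (real^'d \<Rightarrow> real) \<Rightarrow> bool" where
  "test_function \<Omega> \<psi> \<longleftrightarrow> smooth \<psi> \<and> (\<exists>K. compact K \<and> K \<subseteq> \<Omega> \<and> (\<forall>x. x \<notin> K \<longrightarrow> \<psi> x = 0))"

definition square_integrable :: "(real^'d) set \<Rightarrow> (real^'d \<Rightarrow> 'b::euclidean_space) \<Rightarrow> bool" where
  "square_integrable \<Omega> f \<longleftrightarrow>
     f \<in> borel_measurable (lebesgue_on \<Omega>) \<and> integrable (lebesgue_on \<Omega>) (\<lambda>x. (norm (f x))\<^sup>2)"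

definition has_weak_gradient ::
    "(real^'d \<Rightarrow> real) \<Rightarrow> (real^'d \<Rightarrow> real^'d) \<Rightarrow> (real^'d) set \<Rightarrow> bool" where
  "has_weak_gradient u g \<Omega> \<longleftrightarrow>
     (\<forall>\<psi> \<psi>'. test_function \<Omega> \<psi> \<and> (\<forall>x. GDERIV \<psi> x :> \<psi>' x) \<longrightarrow>
        (LINT x|lebesgue_on \<Omega>. u x *\<^sub>R \<psi>' x) = - (LINT x|lebesgue_on \<Omega>. \<psi> x *\<^sub>R g x))"

definition H1 :: "(real^'d) set \<Rightarrow> (real^'d \<Rightarrow> real) set" where
  "H1 \<Omega> = {u. square_integrable \<Omega> u \<and> (\<exists>g. square_integrable \<Omega> g \<and> has_weak_gradient u g \<Omega>)}"

text \<open>A representative of the weak gradient, which is unique up to null sets.\<close>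

definition weak_gradient :: "(real^'d) set \<Rightarrow> (real^'d \<Rightarrow> real) \<Rightarrow> real^'d \<Rightarrow> real^'d" where
  "weak_gradient \<Omega> u = (SOME g. square_integrable \<Omega> g \<and> has_weak_gradient u g \<Omega>)"

text \<open>Equality of the traces on opposite faces of the box, for functions that are continuous up
  to the boundary: the trace of such a function is its restriction to the boundary.\<close>

definition equal_traces_on_opposite_faces :: "real^'d \<Rightarrow> real^'d \<Rightarrow> (real^'d \<Rightarrow> real) \<Rightarrow> bool" where
  "equal_traces_on_opposite_faces a b u \<longleftrightarrow>
     (\<forall>i. \<forall>x\<in>cbox a b. x $ i = a $ i \<longrightarrow> u x = u (x + (b $ i - a $ i) *\<^sub>R axis i 1))"

definition continuous_H1 :: "(real^'d) set \<Rightarrow> (real^'d \<Rightarrow> real) set" where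
  "continuous_H1 \<Omega> = {u \<in> H1 \<Omega>. continuous_on (closure \<Omega>) u}"

definition continuous_H1_periodic :: "real^'d \<Rightarrow> real^'d \<Rightarrow> (real^'d \<Rightarrow> real) set" where
  "continuous_H1_periodic a b =
     {u \<in> continuous_H1 (box a b). equal_traces_on_opposite_faces a b u}"

text \<open>The continuous members of the space $V$ of the two boundary value problems.\<close>

definition neumann_or_periodic_space :: "(real^'d) set \<Rightarrow> (real^'d \<Rightarrow> real) set \<Rightarrow> bool" where
  "neumann_or_periodic_space \<Omega> V \<longleftrightarrow>
     V = continuous_H1 \<Omega> \<or> (\<exists>a b. \<Omega> = box a b \<and> V = continuous_H1_periodic a b)"


section \<open>Finite element basis, coefficients and stiffness matrices\<close>

definition lin_indep_on :: "(real^'d) set \<Rightarrow> ('n::finite \<Rightarrow> real^'d \<Rightarrow> real) \<Rightarrow> bool" where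
  "lin_indep_on \<Omega> \<phi> \<longleftrightarrow>
     (\<forall>c :: 'n \<Rightarrow> real. (\<forall>x\<in>\<Omega>. (\<Sum>k\<in>UNIV. c k * \<phi> k x) = 0) \<longrightarrow> (\<forall>k. c k = 0))"

definition span_contains_constants_on ::
    "(real^'d) set \<Rightarrow> ('n::finite \<Rightarrow> real^'d \<Rightarrow> real) \<Rightarrow> bool" where
  "span_contains_constants_on \<Omega> \<phi> \<longleftrightarrow>
     (\<forall>q::real. \<exists>c :: 'n \<Rightarrow> real. \<forall>x\<in>\<Omega>. (\<Sum>k\<in>UNIV. c k * \<phi> k x) = q)"

definition diffusion_coefficient :: "(real^'d) set \<Rightarrow> (real^'d \<Rightarrow> real^'d^'d) \<Rightarrow> bool" where
  "diffusion_coefficient \<Omega> A \<longleftrightarrow>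
     A \<in> borel_measurable (lebesgue_on \<Omega>) \<and>
     (\<exists>C. AE x in lebesgue_on \<Omega>. norm (A x) \<le> C) \<and>
     (AE x in lebesgue_on \<Omega>. transpose (A x) = A x) \<and>
     (\<exists>c>0. AE x in lebesgue_on \<Omega>. \<forall>\<xi>. c * (norm \<xi>)\<^sup>2 \<le> \<xi> \<bullet> (A x *v \<xi>))"

definition stiffness ::
    "(real^'d) set \<Rightarrow> (real^'d \<Rightarrow> real^'d^'d) \<Rightarrow> ('n::finite \<Rightarrow> real^'d \<Rightarrow> real) \<Rightarrow> real^'n^'n" where
  "stiffness \<Omega> A \<phi> =
     (\<chi> k l. LINT x|lebesgue_on \<Omega>.
        weak_gradient \<Omega> (\<phi> l) x \<bullet> (A x *v weak_gradient \<Omega> (\<phi> k) x))"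


section \<open>Patch-wise bounds\<close>

definition eigenvalues :: "real^'d^'d \<Rightarrow> real set" where
  "eigenvalues M = {\<mu>. \<exists>v. v \<noteq> 0 \<and> M *v v = \<mu> *\<^sub>R v}"

definition eig_min :: "real^'d^'d \<Rightarrow> real" where
  "eig_min M = Min (eigenvalues M)"

definition eig_max :: "real^'d^'d \<Rightarrow> real" where
  "eig_max M = Max (eigenvalues M)"

definition essinf :: "'a measure \<Rightarrow> ('a \<Rightarrow> ereal) \<Rightarrow> ereal" where
  "essinf M f = - esssup M (\<lambda>x. - f x)"

definition alpha_min ::
    "(real^'d \<Rightarrow> real^'d^'d) \<Rightarrow> (real^'d \<Rightarrow> real^'d^'d) \<Rightarrow> (real^'d) set \<Rightarrow> ereal" where
  "alpha_min At A S = essinf (lebesgue_on S) (\<lambda>x. ereal (eig_min (matrix_inv (At x) ** A x)))"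

definition alpha_max ::
    "(real^'d \<Rightarrow> real^'d^'d) \<Rightarrow> (real^'d \<Rightarrow> real^'d^'d) \<Rightarrow> (real^'d) set \<Rightarrow> ereal" where
  "alpha_max At A S = esssup (lebesgue_on S) (\<lambda>x. ereal (eig_max (matrix_inv (At x) ** A x)))"

definition support_in :: "(real^'d) set \<Rightarrow> (real^'d \<Rightarrow> real) \<Rightarrow> (real^'d) set" where
  "support_in \<Omega> f = closure {x\<in>\<Omega>. f x \<noteq> 0}"

text \<open>The smallest union of elements covering the support. For continuous \<open>f\<close> it is the union of
  the elements whose interior meets \<open>{x. f x \<noteq> 0}\<close>: these cover the support, and since elements
  are closures of their pairwise disjoint interiors, every covering union contains them.\<close>

definition patch ::
    "(real^'d) set \<Rightarrow> nat \<Rightarrow> (nat \<Rightarrow> (real^'d) set) \<Rightarrow> (real^'d \<Rightarrow> real) \<Rightarrow> (real^'d) set" where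
  "patch \<Omega> Ne E f =
     (THE P. (\<exists>J\<subseteq>{1..Ne}. P = (\<Union>j\<in>J. E j)) \<and> support_in \<Omega> f \<subseteq> P \<and>
        (\<forall>J\<subseteq>{1..Ne}. support_in \<Omega> f \<subseteq> (\<Union>j\<in>J. E j) \<longrightarrow> P \<subseteq> (\<Union>j\<in>J. E j)))"

definition lambda_L where
  "lambda_L \<Omega> Ne E At A f =
     Min ((\<lambda>j. alpha_min At A (E j)) ` {j\<in>{1..Ne}. E j \<subseteq> patch \<Omega> Ne E f})"

definition lambda_U where
  "lambda_U \<Omega> Ne E At A f =
     Max ((\<lambda>j. alpha_max At A (E j)) ` {j\<in>{1..Ne}. E j \<subseteq> patch \<Omega> Ne E f})"


section \<open>Eigenvalues of the preconditioned matrix\<close>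

definition null_space :: "real^'n^'n \<Rightarrow> (real^'n) set" where
  "null_space M = {v. M *v v = 0}"

text \<open>Eigenspace for \<open>\<mu>\<close> of $\widetilde{\mathsf A}^{-1}\mathsf A$, with both matrices restricted to the
  orthogonal complement \<open>W\<close> of the null space of $\mathsf A$; \<open>inv_into W\<close> is the inverse of the
  restriction of $\widetilde{\mathsf A}$ to \<open>W\<close>.\<close>

definition restricted_eigenspace :: "real^'n^'n \<Rightarrow> real^'n^'n \<Rightarrow> real \<Rightarrow> (real^'n) set" where
  "restricted_eigenspace At A \<mu> =
     (let W = orthogonal_comp (null_space A)
      in {v\<in>W. inv_into W ((*v) At) (A *v v) = \<mu> *\<^sub>R v})"

text \<open>The eigenvalues in nondecreasing order, repeated according to multiplicity. The operator is
  self-adjoint in the inner product given by $\widetilde{\mathsf A}$ on \<open>W\<close>, so that the geometric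
  multiplicity is the algebraic one.\<close>

definition restricted_eigenvalues :: "real^'n^'n \<Rightarrow> real^'n^'n \<Rightarrow> real list" where
  "restricted_eigenvalues At A =
     (THE xs. sorted xs \<and> (\<forall>\<mu>. count_list xs \<mu> = dim (restricted_eigenspace At A \<mu>)))"

text \<open>Numbering starts with $\lambda_2$, as $\lambda_1 = 0$ belongs to the null space.\<close>

definition precond_eigenvalue :: "real^'n^'n \<Rightarrow> real^'n^'n \<Rightarrow> nat \<Rightarrow> real" where
  "precond_eigenvalue At A k = (if k = 1 then 0 else restricted_eigenvalues At A ! (k - 2))"

end

theory Submission
  imports Defs
begin

text \<open>
The proof combines the Courant--Fischer principle with trial spaces spanned by finite element
basis functions. Write \<open>c\<close> for a coefficient vector and \<open>u\<close> for the function it represents. The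
energies of \<open>u\<close> for the two diffusion coefficients are the quadratic forms of the two stiffness
matrices (\<open>stiffness_form\<close>). At almost every point their integrands satisfy a two-sided bound
with the extreme eigenvalues of the pointwise pencil as factors (\<open>eigenvalues_bound_form\<close>). If
\<open>c\<close> is supported in a set \<open>K\<close> of indices, the gradient of \<open>u\<close> vanishes on all elements outside the
patches of \<open>K\<close>, so only the bounds on these patches matter: the Rayleigh quotient of \<open>c\<close> lies
between the least \<open>lambda_L\<close> and the greatest \<open>lambda_U\<close> over \<open>K\<close> (\<open>stiffness_form_ge\<close>,
\<open>stiffness_form_le\<close>).

Let \<open>N\<close> be the number of basis functions. On the orthogonal complement of the null space, of
dimension \<open>N - 1\<close>, both matrices are positive definite and have a common eigenbasis. If \<open>K\<close>
consists of the \<open>k\<close> indices with the smallest upper bounds, the vectors supported in \<open>K\<close> meet the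
span of the eigenvectors for \<open>\<lambda>\<^sub>k, \<dots>, \<lambda>\<^sub>N\<close>, since \<open>k + (N - k + 1) > N\<close>. A common nonzero vector gives
the upper bound for \<open>\<lambda>\<^sub>k\<close>. For the lower bound, the \<open>N - k + 2\<close> indices with the largest lower bounds
are matched with the \<open>k - 1\<close> eigenvectors for \<open>\<lambda>\<^sub>2, \<dots>, \<lambda>\<^sub>k\<close>; this count explains the index
shift in \<open>r (k - 1)\<close>.

Two facts about weak gradients are needed. A function that is constant on an open set has
vanishing weak gradient there (\<open>weak_gradient_eq_0_where_constant\<close>, from the fundamental lemma of
the calculus of variations), and a continuous function with vanishing weak gradient on a
connected open set is constant (\<open>zero_weak_gradient_imp_constant\<close>). Together they identify the
null space of either matrix with the representations of constants. Both rest on explicit smooth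
bump functions: tensor products of functions built from \<open>exp (- 1 / t)\<close>.
\<close>

section \<open>Symmetric pencils on a subspace\<close>

lemma inner_matrix_symmetric:
  fixes M :: "real^'n^'n"
  assumes "transpose M = M"
  shows "x \<bullet> (M *v y) = y \<bullet> (M *v x)"
  by (metis assms dot_lmul_matrix inner_commute transpose_matrix_vector)

text \<open>A simultaneous diagonalization of two symmetric forms on a subspace \<open>W\<close>. The eigenvalue equation
is tested against vectors of \<open>W\<close> alone. So the same notion covers the coefficient matrices at a
point, with \<open>W\<close> the whole space, and the singular stiffness matrices, with \<open>W\<close> the orthogonal
complement of their null space. Numbering by natural numbers in nondecreasing order is what the
min-max arguments and the sorted list of eigenvalues refer to.\<close>

locale pencil_eigenbasis =
  fixes A B :: "real^'n^'n" and W :: "(real^'n) set"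
    and v :: "nat \<Rightarrow> real^'n" and \<mu> :: "nat \<Rightarrow> real"
  assumes subspace: "subspace W"
    and sym_A: "transpose A = A" and sym_B: "transpose B = B"
    and in_W: "i < dim W \<Longrightarrow> v i \<in> W"
    and orthonormal: "i < dim W \<Longrightarrow> j < dim W \<Longrightarrow> v i \<bullet> (B *v v j) = (if i = j then 1 else 0)"
    and eigen: "i < dim W \<Longrightarrow> w \<in> W \<Longrightarrow> w \<bullet> (A *v v i) = \<mu> i * (w \<bullet> (B *v v i))"
    and expansion: "w \<in> W \<Longrightarrow> w = (\<Sum>i<dim W. (w \<bullet> (B *v v i)) *\<^sub>R v i)"
    and mono: "i \<le> j \<Longrightarrow> j < dim W \<Longrightarrow> \<mu> i \<le> \<mu> j"

text \<open>The Rayleigh quotient attains its minimum \<open>\<mu>\<close> on the unit sphere of \<open>W\<close>. The form of \<open>A - \<mu> B\<close> is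
then positive semidefinite on \<open>W\<close> and vanishes at the minimizer, hence the minimizer lies in its
kernel: this is the eigenvalue equation.\<close>

lemma Rayleigh_quotient_minimizer:
  fixes A B :: "real^'n^'n"
  assumes W: "subspace W" "W \<noteq> {0}"
    and symA: "transpose A = A" and symB: "transpose B = B"
    and pos: "\<And>w. w \<in> W \<Longrightarrow> w \<noteq> 0 \<Longrightarrow> 0 < w \<bullet> (B *v w)"
  obtains v \<mu> where "v \<in> W" "v \<bullet> (B *v v) = 1"
    "\<And>w. w \<in> W \<Longrightarrow> w \<bullet> (A *v v) = \<mu> * (w \<bullet> (B *v v))"
    "\<And>w. w \<in> W \<Longrightarrow> \<mu> * (w \<bullet> (B *v w)) \<le> w \<bullet> (A *v w)"
proof -
  let ?R = "\<lambda>w. (w \<bullet> (A *v w)) / (w \<bullet> (B *v w))"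
  let ?K = "sphere 0 1 \<inter> W"
  obtain w0 where w0: "w0 \<in> W" "w0 \<noteq> 0"
    using W subspace_0 by blast
  have "w0 /\<^sub>R norm w0 \<in> ?K"
    using w0 W by (simp add: subspace_scale)
  moreover have "compact ?K"
    using W by (simp add: closed_subspace compact_Int_closed)
  moreover have "continuous_on ?K ?R"
  proof (intro continuous_intros ballI)
    fix w assume "w \<in> ?K"
    then have "w \<in> W" "w \<noteq> 0" by auto
    then show "w \<bullet> (B *v w) \<noteq> 0" using pos by fastforce
  qed
  ultimately obtain u where u: "u \<in> ?K" and min: "\<And>w. w \<in> ?K \<Longrightarrow> ?R u \<le> ?R w"
    using continuous_attains_inf[of ?K ?R] by blast
  define \<mu> where "\<mu> = ?R u"
  have u': "u \<in> W" "u \<noteq> 0" using u by auto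
  have low: "\<mu> * (w \<bullet> (B *v w)) \<le> w \<bullet> (A *v w)" if "w \<in> W" for w
  proof (cases "w = 0")
    case False
    have "w /\<^sub>R norm w \<in> ?K" using that W False by (simp add: subspace_scale)
    from min[OF this] have "\<mu> \<le> ?R w"
      using False by (simp add: \<mu>_def matrix_vector_mult_scaleR)
    then show ?thesis using pos[OF that False] by (simp add: pos_le_divide_eq)
  qed simp
  have eig: "w \<bullet> (A *v u) = \<mu> * (w \<bullet> (B *v u))" if w: "w \<in> W" for w
  proof -
    let ?p = "w \<bullet> (A *v u) - \<mu> * (w \<bullet> (B *v u))"
    let ?q = "w \<bullet> (A *v w) - \<mu> * (w \<bullet> (B *v w))"
    have z: "u \<bullet> (A *v u) = \<mu> * (u \<bullet> (B *v u))"
      using pos[OF u'] by (simp add: \<mu>_def)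
    have ineq: "0 \<le> 2 * t * ?p + t^2 * ?q" for t
    proof -
      have "u + t *\<^sub>R w \<in> W" using u' w W by (simp add: subspace_add subspace_scale)
      from low[OF this] show ?thesis
        using z inner_matrix_symmetric[OF symA, of u w] inner_matrix_symmetric[OF symB, of u w]
        by (simp add: matrix_vector_mult_scaleR matrix_vector_right_distrib inner_add_left inner_add_right
            algebra_simps power2_eq_square)
    qed
    have "?q \<ge> 0" using low[OF w] by simp
    \<comment> \<open>This value of \<open>t\<close> makes the right-hand side negative unless
      \<open>?p = 0\<close>; the summand 1 keeps the denominator positive when \<open>?q =
      0\<close>.\<close>
    have "0 \<le> 2 * (- ?p / (?q + 1)) * ?p + (- ?p / (?q + 1))^2 * ?q" by (rule ineq)
    also have "\<dots> = - (?p^2 * (?q + 2) / (?q + 1)^2)"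
      using \<open>?q \<ge> 0\<close> by (simp add: divide_simps) (simp add: algebra_simps power2_eq_square)
    finally have "?p^2 * (?q + 2) / (?q + 1)^2 \<le> 0" by linarith
    then have "?p^2 \<le> 0" using \<open>?q \<ge> 0\<close>
      by (simp add: divide_le_0_iff mult_le_0_iff)
    then show ?thesis by simp
  qed
  define c where "c = 1 / sqrt (u \<bullet> (B *v u))"
  have c: "c * c * (u \<bullet> (B *v u)) = 1" using pos[OF u'] by (simp add: c_def)
  show ?thesis
  proof
    show "c *\<^sub>R u \<in> W" using u' W by (simp add: subspace_scale)
    show "(c *\<^sub>R u) \<bullet> (B *v (c *\<^sub>R u)) = 1"
      using c by (simp add: matrix_vector_mult_scaleR mult.assoc)
    show "w \<bullet> (A *v (c *\<^sub>R u)) = \<mu> * (w \<bullet> (B *v (c *\<^sub>R u)))" if "w \<in> W" for w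
      using eig[OF that] by (simp add: matrix_vector_mult_scaleR)
  qed (rule low)
qed

text \<open>Induction on the dimension: a minimizer of the Rayleigh quotient comes first, followed by an
eigenbasis of its \<open>B\<close>-orthogonal complement in \<open>W\<close>. As each vector minimizes over everything that
comes later, the eigenvalues are found in nondecreasing order.\<close>

lemma pencil_eigenbasis_exists:
  fixes A B :: "real^'n^'n"
  assumes "subspace W"
    and symA: "transpose A = A" and symB: "transpose B = B"
    and "\<And>w. w \<in> W \<Longrightarrow> w \<noteq> 0 \<Longrightarrow> 0 < w \<bullet> (B *v w)"
  shows "\<exists>v \<mu>. pencil_eigenbasis A B W v \<mu>"
  using assms(1,4)
proof (induction "dim W" arbitrary: W)
  case 0
  then have "W = {0}" using subspace_0[of W] by auto
  then have "pencil_eigenbasis A B W (\<lambda>i. 0) (\<lambda>i. 0)"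
    using 0 symA symB by unfold_locales auto
  then show ?case by blast
next
  case (Suc m)
  have "W \<noteq> {0}" using Suc.hyps(2) by (metis dim_singleton dim_span nat.distinct(1) dim_eq_0 subset_refl)
  obtain u \<nu> where u: "u \<in> W" "u \<bullet> (B *v u) = 1"
    and eig: "\<And>w. w \<in> W \<Longrightarrow> w \<bullet> (A *v u) = \<nu> * (w \<bullet> (B *v u))"
    and low: "\<And>w. w \<in> W \<Longrightarrow> \<nu> * (w \<bullet> (B *v w)) \<le> w \<bullet> (A *v w)"
    using Rayleigh_quotient_minimizer[OF Suc.prems(1) \<open>W \<noteq> {0}\<close> symA symB Suc.prems(2)] by blast
  have symb: "x \<bullet> (B *v y) = y \<bullet> (B *v x)" for x y by (rule inner_matrix_symmetric[OF symB])
  define W' where "W' = {w \<in> W. w \<bullet> (B *v u) = 0}"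
  have sub': "subspace W'"
    using Suc.prems(1) unfolding W'_def subspace_def by (auto simp: inner_add_left)
  have split: "w - (w \<bullet> (B *v u)) *\<^sub>R u \<in> W'" if "w \<in> W" for w
    using that u Suc.prems(1) unfolding W'_def
    by (simp add: subspace_diff subspace_scale inner_diff_left)
  have "u \<notin> W'" using u by (simp add: W'_def)
  have "W = span (insert u W')"
  proof (intro equalityI subsetI)
    fix w assume w: "w \<in> W"
    have "w = (w - (w \<bullet> (B *v u)) *\<^sub>R u) + (w \<bullet> (B *v u)) *\<^sub>R u" by simp
    also have "\<dots> \<in> span (insert u W')"
      by (intro span_add span_scale) (use split[OF w] in \<open>auto intro: span_base\<close>)
    finally show "w \<in> span (insert u W')" .
  next
    fix w assume "w \<in> span (insert u W')"
    then show "w \<in> W"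
      by (metis (no_types, lifting) Suc.prems(1) W'_def insert_subset mem_Collect_eq span_minimal subsetD subsetI u(1))
  qed
  then have "dim W = Suc (dim W')"
    using dim_insert[of u W'] \<open>u \<notin> W'\<close> sub' by (metis dim_span span_eq_iff Suc_eq_plus1)
  then have m: "m = dim W'" using Suc.hyps(2) by simp
  have "0 < w \<bullet> (B *v w)" if "w \<in> W'" "w \<noteq> 0" for w
    using that Suc.prems(2) by (simp add: W'_def)
  with Suc.hyps(1)[OF m sub'] obtain v \<mu> where "pencil_eigenbasis A B W' v \<mu>" by blast
  then interpret sub: pencil_eigenbasis A B W' v \<mu> .
  have dimW: "dim W = Suc (dim W')" by fact
  have vW: "v i \<in> W" "v i \<bullet> (B *v u) = 0" "u \<bullet> (B *v v i) = 0" if "i < dim W'" for i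
    using sub.in_W[OF that] symb[of u "v i"] by (auto simp: W'_def)
  define v' where "v' = case_nat u v"
  define \<mu>' where "\<mu>' = case_nat \<nu> \<mu>"
  have "pencil_eigenbasis A B W v' \<mu>'"
  proof
    show "subspace W" by fact
    show "transpose A = A" "transpose B = B" by fact+
    show "v' i \<in> W" if "i < dim W" for i
      using that u vW dimW by (cases i) (auto simp: v'_def)
    show "v' i \<bullet> (B *v v' j) = (if i = j then 1 else 0)" if "i < dim W" "j < dim W" for i j
      using that u vW sub.orthonormal dimW
      by (cases i; cases j) (auto simp: v'_def)
    show "w \<bullet> (A *v v' i) = \<mu>' i * (w \<bullet> (B *v v' i))" if i: "i < dim W" and w: "w \<in> W" for i w
    proof (cases i)
      case 0
      then show ?thesis using eig[OF w] by (simp add: v'_def \<mu>'_def)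
    next
      case (Suc j)
      then have j: "j < dim W'" using i dimW by simp
      have "u \<bullet> (A *v v j) = 0"
        using eig[OF vW(1)[OF j]] vW(2)[OF j] inner_matrix_symmetric[OF symA] by simp
      then show ?thesis
        using vW(3)[OF j] sub.eigen[OF j split[OF w]] Suc by (simp add: v'_def \<mu>'_def inner_diff_left)
    qed
    show "w = (\<Sum>i<dim W. (w \<bullet> (B *v v' i)) *\<^sub>R v' i)" if w: "w \<in> W" for w
    proof -
      have "w - (w \<bullet> (B *v u)) *\<^sub>R u = (\<Sum>i<dim W'. (w \<bullet> (B *v v i)) *\<^sub>R v i)"
        by (subst sub.expansion[OF split[OF w]]) (auto intro!: sum.cong simp: inner_diff_left vW)
      then show ?thesis
        unfolding dimW by (subst sum.lessThan_Suc_shift) (simp add: v'_def algebra_simps)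
    qed
    show "\<mu>' i \<le> \<mu>' j" if "i \<le> j" "j < dim W" for i j
    proof (cases j)
      case 0
      then show ?thesis using that by simp
    next
      case (Suc j')
      then have j: "j' < dim W'" using that dimW by simp
      have "\<nu> \<le> \<mu> j'"
        using low[OF vW(1)[OF j]] sub.eigen[OF j sub.in_W[OF j]] sub.orthonormal[OF j j] by simp
      then show ?thesis
        using Suc that sub.mono j by (cases i) (auto simp: \<mu>'_def)
    qed
  qed
  then show ?case by blast
qed

context pencil_eigenbasis
begin

abbreviation coord :: "real^'n \<Rightarrow> nat \<Rightarrow> real" where
  "coord w i \<equiv> w \<bullet> (B *v v i)"

lemma inner_expansion:
  assumes "w \<in> W"
  shows "z \<bullet> (M *v w) = (\<Sum>i<dim W. coord w i * (z \<bullet> (M *v v i)))"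
proof -
  have "M *v w = (\<Sum>i<dim W. coord w i *\<^sub>R (M *v v i))"
    by (subst expansion[OF assms])
      (simp add: linear_sum[OF matrix_vector_mul_linear] matrix_vector_mult_scaleR)
  then show ?thesis by (simp add: inner_sum_right)
qed

lemma form_A: "w \<in> W \<Longrightarrow> w \<bullet> (A *v w) = (\<Sum>i<dim W. \<mu> i * (coord w i)\<^sup>2)"
  by (subst inner_expansion) (auto simp: eigen power2_eq_square intro!: sum.cong)

lemma form_B: "w \<in> W \<Longrightarrow> w \<bullet> (B *v w) = (\<Sum>i<dim W. (coord w i)\<^sup>2)"
  by (subst inner_expansion) (auto simp: power2_eq_square intro!: sum.cong)

lemma independent_basis: "inj_on v {..<dim W}" "independent (v ` {..<dim W})"
proof -
  show inj: "inj_on v {..<dim W}"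
    by (rule inj_onI) (metis lessThan_iff orthonormal zero_neq_one)
  have "c i = 0" if "(\<Sum>i<dim W. c i *\<^sub>R v i) = 0" "i < dim W" for c i
  proof -
    have "0 = (\<Sum>j<dim W. c j *\<^sub>R v j) \<bullet> (B *v v i)" using that by simp
    also have "\<dots> = (\<Sum>j<dim W. c j * (if j = i then 1 else 0))"
      using that(2) by (simp add: inner_sum_left orthonormal)
    also have "\<dots> = c i" using that(2) by (simp add: if_distrib[of "\<lambda>x. _ * x"] cong: if_cong)
    finally show ?thesis by simp
  qed
  then show "independent (v ` {..<dim W})"
    unfolding independent_explicit_finite_subsets
  proof (intro allI impI ballI)
    fix S c x assume *: "\<And>c i. (\<Sum>i<dim W. c i *\<^sub>R v i) = 0 \<Longrightarrow> i < dim W \<Longrightarrow> c i = 0"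
      and S: "S \<subseteq> v ` {..<dim W}" "finite S" "(\<Sum>x\<in>S. c x *\<^sub>R x) = 0" "x \<in> S"
    obtain i where i: "i < dim W" "x = v i" using S by auto
    have "(\<Sum>i<dim W. (if v i \<in> S then c (v i) else 0) *\<^sub>R v i) =
        (\<Sum>x\<in>v ` {..<dim W}. (if x \<in> S then c x else 0) *\<^sub>R x)"
      using inj by (simp add: sum.reindex)
    also have "\<dots> = (\<Sum>x\<in>S. c x *\<^sub>R x)"
      using S by (intro sum.mono_neutral_cong_right) auto
    finally have "(\<Sum>i<dim W. (if v i \<in> S then c (v i) else 0) *\<^sub>R v i) = 0" using S by simp
    from *[OF this i(1)] show "c x = 0" using S i by simp
  qed
qed

lemma dim_span_basis: "I \<subseteq> {..<dim W} \<Longrightarrow> dim (span (v ` I)) = card I"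
  by (metis card_image dim_eq_card_independent dim_span image_mono independent_basis independent_mono inj_on_subset)

lemma span_basis_subset: "I \<subseteq> {..<dim W} \<Longrightarrow> span (v ` I) \<subseteq> W"
  using in_W subspace by (intro span_minimal) auto

lemma coord_span_eq_0:
  assumes "w \<in> span (v ` I)" "I \<subseteq> {..<dim W}" "j < dim W" "j \<notin> I"
  shows "coord w j = 0"
  using assms(1)
proof (induction rule: span_induct)
  case base
  then show ?case by (auto simp: subspace_def inner_add_left)
next
  case (step x)
  then show ?case using assms orthonormal by auto
qed

lemma eigenspace_eq_span:
  "{w \<in> W. \<forall>z\<in>W. z \<bullet> (A *v w) = x * (z \<bullet> (B *v w))} = span (v ` {i. i < dim W \<and> \<mu> i = x})"
    (is "?L = span (v ` ?I)")
proof (intro equalityI subsetI)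
  fix w assume w: "w \<in> ?L"
  have "coord w i = 0" if i: "i < dim W" "\<mu> i \<noteq> x" for i
  proof -
    have "\<mu> i * coord w i = x * coord w i"
      using eigen[OF i(1), of w] w in_W[OF i(1)] inner_matrix_symmetric[OF sym_A, of w]
        inner_matrix_symmetric[OF sym_B, of w] by auto
    then show ?thesis using i(2) by simp
  qed
  then have "w = (\<Sum>i\<in>?I. coord w i *\<^sub>R v i)"
    using w expansion[of w] sum.mono_neutral_right[of "{..<dim W}" ?I "\<lambda>i. coord w i *\<^sub>R v i"]
    by (smt (verit, ccfv_threshold) DiffE finite_lessThan lessThan_iff mem_Collect_eq scale_eq_0_iff subsetI)
  then show "w \<in> span (v ` ?I)"
    by (metis (no_types, lifting) imageI span_base span_scale span_sum)
next
  fix w assume "w \<in> span (v ` ?I)"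
  moreover have "span (v ` ?I) \<subseteq> ?L"
  proof (rule span_minimal)
    show "v ` ?I \<subseteq> ?L" using eigen in_W by auto
    show "subspace ?L"
      using subspace unfolding subspace_def
      by (auto simp: matrix_vector_right_distrib inner_add_right matrix_vector_mult_scaleR algebra_simps)
  qed
  ultimately show "w \<in> ?L" by blast
qed

lemma dim_eigenspace:
  "dim {w \<in> W. \<forall>z\<in>W. z \<bullet> (A *v w) = x * (z \<bullet> (B *v w))} = card {i. i < dim W \<and> \<mu> i = x}"
  unfolding eigenspace_eq_span by (rule dim_span_basis) auto

text \<open>The half of the Courant--Fischer principle that bounds eigenvalues from above. A dimension count
gives a common nonzero vector of \<open>S\<close> and the span of the eigenvectors from number \<open>k\<close> on. There
the Rayleigh quotient is at least \<open>\<mu> k\<close> and at most \<open>t\<close>. The space \<open>S\<close> may stick out of \<open>W\<close>, as the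
coordinate subspaces do to which this is applied.\<close>

lemma eigenvalue_le_if_form_le:
  assumes "subspace S" "k < dim W" "CARD('n) + k < dim S + dim W"
    and pos: "\<And>w. w \<in> W \<Longrightarrow> w \<noteq> 0 \<Longrightarrow> 0 < w \<bullet> (B *v w)"
    and le: "\<And>w. w \<in> S \<Longrightarrow> w \<bullet> (A *v w) \<le> t * (w \<bullet> (B *v w))"
  shows "\<mu> k \<le> t"
proof -
  let ?I = "{k..<dim W}"
  have I: "?I \<subseteq> {..<dim W}" by auto
  let ?T = "span (v ` ?I)"
  have "dim {x + y |x y. x \<in> S \<and> y \<in> ?T} + dim (S \<inter> ?T) = dim S + (dim W - k)"
    using dim_sums_Int[OF assms(1) subspace_span] dim_span_basis[OF I] by simp
  moreover have "dim {x + y |x y. x \<in> S \<and> y \<in> ?T} \<le> CARD('n)"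
    using dim_subset_UNIV[of "{x + y |x y. x \<in> S \<and> y \<in> ?T}"] by simp
  ultimately have "dim (S \<inter> ?T) \<noteq> 0" using assms by linarith
  then obtain w where w: "w \<in> S" "w \<in> ?T" "w \<noteq> 0" by auto
  have wW: "w \<in> W" using span_basis_subset[OF I] w by blast
  have "\<mu> k * (w \<bullet> (B *v w)) = (\<Sum>i<dim W. \<mu> k * (coord w i)\<^sup>2)"
    by (simp add: form_B[OF wW] sum_distrib_left)
  also have "\<dots> \<le> (\<Sum>i<dim W. \<mu> i * (coord w i)\<^sup>2)"
  proof (rule sum_mono)
    fix i assume i: "i \<in> {..<dim W}"
    show "\<mu> k * (coord w i)\<^sup>2 \<le> \<mu> i * (coord w i)\<^sup>2"
      using i mono[of k i] coord_span_eq_0[OF w(2) I, of i]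
      by (cases "k \<le> i") (auto intro!: mult_right_mono)
  qed
  also have "\<dots> \<le> t * (w \<bullet> (B *v w))" using le[OF w(1)] form_A[OF wW] by simp
  finally show ?thesis using pos[OF wW w(3)] by simp
qed

text \<open>The dual half: here \<open>S\<close> meets the span of the eigenvectors up to number \<open>k\<close>, where the Rayleigh
quotient is at most \<open>\<mu> k\<close>.\<close>

lemma eigenvalue_ge_if_form_ge:
  assumes "subspace S" "k < dim W" "CARD('n) \<le> dim S + k"
    and pos: "\<And>w. w \<in> W \<Longrightarrow> w \<noteq> 0 \<Longrightarrow> 0 < w \<bullet> (B *v w)"
    and ge: "\<And>w. w \<in> S \<Longrightarrow> t * (w \<bullet> (B *v w)) \<le> w \<bullet> (A *v w)"
  shows "t \<le> \<mu> k"
proof -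
  let ?I = "{..k}"
  have I: "?I \<subseteq> {..<dim W}" using assms by auto
  let ?T = "span (v ` ?I)"
  have "dim {x + y |x y. x \<in> S \<and> y \<in> ?T} + dim (S \<inter> ?T) = dim S + Suc k"
    using dim_sums_Int[OF assms(1) subspace_span] dim_span_basis[OF I] by simp
  moreover have "dim {x + y |x y. x \<in> S \<and> y \<in> ?T} \<le> CARD('n)"
    using dim_subset_UNIV[of "{x + y |x y. x \<in> S \<and> y \<in> ?T}"] by simp
  ultimately have "dim (S \<inter> ?T) \<noteq> 0" using assms by linarith
  then obtain w where w: "w \<in> S" "w \<in> ?T" "w \<noteq> 0" by auto
  have wW: "w \<in> W" using span_basis_subset[OF I] w by blast
  have "t * (w \<bullet> (B *v w)) \<le> (\<Sum>i<dim W. \<mu> i * (coord w i)\<^sup>2)"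
    using ge[OF w(1)] form_A[OF wW] by simp
  also have "\<dots> \<le> (\<Sum>i<dim W. \<mu> k * (coord w i)\<^sup>2)"
  proof (rule sum_mono)
    fix i assume i: "i \<in> {..<dim W}"
    show "\<mu> i * (coord w i)\<^sup>2 \<le> \<mu> k * (coord w i)\<^sup>2"
      using i mono[of i k] coord_span_eq_0[OF w(2) I, of i] assms
      by (cases "i \<le> k") (auto intro!: mult_right_mono)
  qed
  also have "\<dots> = \<mu> k * (w \<bullet> (B *v w))"
    by (simp add: form_B[OF wW] sum_distrib_left)
  finally show ?thesis using pos[OF wW w(3)] by simp
qed

end

text \<open>For positive definite \<open>B\<close> the eigenvalues of \<open>matrix_inv B ** A\<close> are those of the pencil, and in an
eigenbasis the two forms are sums of squares whose coefficients have these eigenvalues as ratios.\<close>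

lemma eigenvalues_bound_form:
  fixes A B :: "real^'n^'n"
  assumes symA: "transpose A = A" and symB: "transpose B = B"
    and pos: "\<And>w. w \<noteq> 0 \<Longrightarrow> 0 < w \<bullet> (B *v w)"
  shows "eig_min (matrix_inv B ** A) * (w \<bullet> (B *v w)) \<le> w \<bullet> (A *v w)"
    and "w \<bullet> (A *v w) \<le> eig_max (matrix_inv B ** A) * (w \<bullet> (B *v w))"
proof -
  obtain v \<mu> where "pencil_eigenbasis A B UNIV v \<mu>"
    using pencil_eigenbasis_exists[OF subspace_UNIV symA symB pos] by blast
  then interpret pencil_eigenbasis A B UNIV v \<mu> .
  have "inj ((*v) B)"
    by (subst linear_injective_0[OF matrix_vector_mul_linear]) (metis pos inner_zero_right less_irrefl)
  then have "invertible B" by (simp add: matrix_left_invertible_injective invertible_left_inverse)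
  then have inv: "matrix_inv B ** B = mat 1" "B ** matrix_inv B = mat 1"
    unfolding invertible_def matrix_inv_def by (metis (mono_tags, lifting) someI_ex)+
  have pencil: "(matrix_inv B ** A) *v w = x *\<^sub>R w \<longleftrightarrow> A *v w = x *\<^sub>R (B *v w)" for x w
    by (metis inv matrix_vector_mul_assoc matrix_vector_mul_lid matrix_vector_mult_scaleR)
  have space: "{w. (matrix_inv B ** A) *v w = x *\<^sub>R w} = span (v ` {i. i < DIM(real^'n) \<and> \<mu> i = x})" for x
  proof -
    have "{w. (matrix_inv B ** A) *v w = x *\<^sub>R w} =
       {w \<in> UNIV. \<forall>z\<in>UNIV. z \<bullet> (A *v w) = x * (z \<bullet> (B *v w))}"
      unfolding pencil by (auto simp flip: inner_scaleR_right simp: vector_eq_ldot)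
    then show ?thesis using eigenspace_eq_span[of x] by simp
  qed
  have "eigenvalues (matrix_inv B ** A) = \<mu> ` {..<DIM(real^'n)}" (is "?E = ?M")
  proof (intro equalityI subsetI)
    fix x assume "x \<in> ?E"
    then obtain w where "w \<noteq> 0" "w \<in> span (v ` {i. i < DIM(real^'n) \<and> \<mu> i = x})"
      unfolding space[symmetric] eigenvalues_def by auto
    then have "{i. i < DIM(real^'n) \<and> \<mu> i = x} \<noteq> {}" by (metis image_empty singletonD span_empty)
    then show "x \<in> ?M" by auto
  next
    fix x assume "x \<in> ?M"
    then obtain i where i: "i < DIM(real^'n)" "\<mu> i = x" by auto
    then have "v i \<in> {w. (matrix_inv B ** A) *v w = x *\<^sub>R w}"
      unfolding space by (auto intro: span_base)
    moreover have "v i \<noteq> 0"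
      using orthonormal[of i i] i by (auto simp del: DIM_cart)
    ultimately show "x \<in> ?E" by (auto simp: eigenvalues_def)
  qed
  then have "eig_min (matrix_inv B ** A) \<le> \<mu> i" "\<mu> i \<le> eig_max (matrix_inv B ** A)"
    if "i < DIM(real^'n)" for i
    using that by (auto simp: eig_min_def eig_max_def simp del: DIM_cart)
  then show "eig_min (matrix_inv B ** A) * (w \<bullet> (B *v w)) \<le> w \<bullet> (A *v w)"
     "w \<bullet> (A *v w) \<le> eig_max (matrix_inv B ** A) * (w \<bullet> (B *v w))"
    by (auto simp: form_A form_B sum_distrib_left simp del: DIM_cart intro!: sum_mono mult_right_mono)
qed

section \<open>The restricted eigenvalue list\<close>

context pencil_eigenbasis
begin

lemma form_at_basis: "i < dim W \<Longrightarrow> v i \<bullet> (A *v v i) = \<mu> i"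
  by (simp add: eigen in_W orthonormal)

lemma count_list_eigenvalues:
  "count_list (map \<mu> [0..<dim W]) x = dim {w \<in> W. \<forall>z\<in>W. z \<bullet> (A *v w) = x * (z \<bullet> (B *v w))}"
proof -
  have "count_list (map \<mu> [0..<dim W]) x = length (filter ((=) x) (map \<mu> [0..<dim W]))"
    by (simp add: count_list_eq_length_filter)
  also have "\<dots> = card {i. i < dim W \<and> \<mu> i = x}"
    unfolding length_filter_conv_card by (rule arg_cong[where f = card]) auto
  finally show ?thesis by (simp add: dim_eigenspace)
qed

lemma sorted_eigenvalues: "sorted (map \<mu> [0..<dim W])"
  unfolding sorted_iff_nth_mono by (auto intro: mono)

end

lemma sorted_list_eqI:
  fixes xs ys :: "'a::linorder list"
  assumes "sorted xs" "sorted ys" "\<And>x. count_list xs x = count_list ys x"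
  shows "xs = ys"
proof -
  have "mset xs = mset ys" using assms(3) by (intro multiset_eqI) (simp add: count_mset)
  then show ?thesis using assms(1,2) by (metis properties_for_sort)
qed

lemma symmetric_maps_to_null_space_comp:
  fixes M :: "real^'n^'n"
  assumes "transpose M = M"
  shows "M *v w \<in> orthogonal_comp (null_space M)"
  unfolding orthogonal_comp_def orthogonal_def
  using inner_matrix_symmetric[OF assms] by (auto simp: null_space_def) (metis inner_zero_right)

lemma subspace_null_space: "subspace (null_space M)"
  unfolding subspace_def null_space_def
  by (auto simp: matrix_vector_right_distrib matrix_vector_mult_scaleR)

lemma null_space_Int_comp: "null_space M \<inter> orthogonal_comp (null_space M) = {0}"
  using subspace_null_space[of M] by (auto simp: orthogonal_comp_def orthogonal_def subspace_0)

text \<open>The range of a symmetric matrix is orthogonal to its null space, so the matrix acts injectively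
on the orthogonal complement; this makes the restricted inverse in \<open>restricted_eigenspace\<close> a
genuine inverse.\<close>

lemma bij_betw_symmetric_on_null_space_comp:
  fixes M :: "real^'n^'n"
  assumes "transpose M = M"
  defines "W \<equiv> orthogonal_comp (null_space M)"
  shows "bij_betw ((*v) M) W W"
proof -
  have W: "subspace W" unfolding W_def by (rule subspace_orthogonal_comp)
  have inj: "inj_on ((*v) M) W"
  proof (rule inj_onI)
    fix x y assume "x \<in> W" "y \<in> W" "M *v x = M *v y"
    then have "x - y \<in> null_space M \<inter> W"
      using W by (simp add: null_space_def matrix_vector_mult_diff_distrib subspace_diff)
    then show "x = y" using null_space_Int_comp[of M] by (simp add: W_def)
  qed
  have "(*v) M ` W = W"
  proof (rule subspace_dim_equal)
    show "subspace ((*v) M ` W)" using W by (rule linear_subspace_image[OF matrix_vector_mul_linear])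
    show "(*v) M ` W \<subseteq> W" using symmetric_maps_to_null_space_comp[OF assms(1)] by (auto simp: W_def)
    have span: "span W = W" using W by (simp add: span_eq_iff)
    have "dim ((*v) M ` W) = dim W"
      by (rule dim_image_eq[OF matrix_vector_mul_linear]) (simp only: span inj)
    then show "dim ((*v) M ` W) \<ge> dim W" by simp
  qed (rule W)
  then show ?thesis using inj by (simp add: bij_betw_def)
qed

text \<open>Applying the second matrix turns the equation with the restricted inverse into one
between vectors of \<open>W\<close>, and such vectors are determined by their inner products with \<open>W\<close>.\<close>

lemma restricted_eigenspace_eq:
  fixes A B :: "real^'n^'n"
  assumes A: "transpose A = A" and B: "transpose B = B" and null: "null_space A = null_space B"
  defines "W \<equiv> orthogonal_comp (null_space A)"
  shows "restricted_eigenspace B A x = {w \<in> W. \<forall>z\<in>W. z \<bullet> (A *v w) = x * (z \<bullet> (B *v w))}"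
proof -
  have bij: "bij_betw ((*v) B) W W"
    using bij_betw_symmetric_on_null_space_comp[OF B] by (simp add: W_def null)
  have W: "subspace W" unfolding W_def by (rule subspace_orthogonal_comp)
  have "inv_into W ((*v) B) (A *v w) = x *\<^sub>R w \<longleftrightarrow> (\<forall>z\<in>W. z \<bullet> (A *v w) = x * (z \<bullet> (B *v w)))"
    if w: "w \<in> W" for w
  proof -
    have AW: "A *v w \<in> W" unfolding W_def by (rule symmetric_maps_to_null_space_comp[OF A])
    have BW: "B *v w \<in> W" using bij_betwE[OF bij] w by blast
    have xw: "x *\<^sub>R w \<in> W" using W w by (rule subspace_scale)
    have "inv_into W ((*v) B) (A *v w) = x *\<^sub>R w \<longleftrightarrow> A *v w = B *v (x *\<^sub>R w)"
      by (metis AW bij bij_betw_inv_into_left bij_betw_inv_into_right xw)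
    also have "\<dots> \<longleftrightarrow> A *v w - x *\<^sub>R (B *v w) = 0"
      by (simp add: matrix_vector_mult_scaleR)
    also have "\<dots> \<longleftrightarrow> (\<forall>z\<in>W. z \<bullet> (A *v w - x *\<^sub>R (B *v w)) = 0)"
    proof
      assume *: "\<forall>z\<in>W. z \<bullet> (A *v w - x *\<^sub>R (B *v w)) = 0"
      have "A *v w - x *\<^sub>R (B *v w) \<in> W" using W AW BW by (simp add: subspace_diff subspace_scale)
      then show "A *v w - x *\<^sub>R (B *v w) = 0" using * inner_eq_zero_iff by blast
    qed simp
    finally show ?thesis by (simp add: inner_diff_right)
  qed
  then show ?thesis unfolding restricted_eigenspace_def Let_def W_def[symmetric] by blast
qed

lemma restricted_eigenvalues_eq:
  fixes A B :: "real^'n^'n"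
  assumes null: "null_space A = null_space B"
    and basis: "pencil_eigenbasis A B (orthogonal_comp (null_space A)) v \<mu>"
  shows "restricted_eigenvalues B A = map \<mu> [0..<dim (orthogonal_comp (null_space A))]"
proof -
  interpret pencil_eigenbasis A B "orthogonal_comp (null_space A)" v \<mu> by (rule basis)
  note space = restricted_eigenspace_eq[OF sym_A sym_B null]
  show ?thesis
    unfolding restricted_eigenvalues_def space
    using sorted_eigenvalues count_list_eigenvalues by (intro the_equality) (auto intro: sorted_list_eqI)
qed

lemma dim_orthogonal_comp:
  fixes S :: "'a::euclidean_space set"
  assumes "subspace S"
  shows "dim (orthogonal_comp S) + dim S = DIM('a)"
proof -
  have "orthogonal_comp S = {y \<in> UNIV. \<forall>x\<in>S. orthogonal x y}"
    by (auto simp: orthogonal_comp_def orthogonal_def inner_commute)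
  then show ?thesis
    using dim_subspace_orthogonal_to_vectors[OF assms subspace_UNIV] by simp
qed

section \<open>Smooth test functions\<close>

text \<open>A smooth function of one variable together with all its derivatives. With the derivatives at hand
explicitly, iterated partial derivatives of tensor products can be written down directly.\<close>

definition smooth_jet :: "(nat \<Rightarrow> real \<Rightarrow> real) \<Rightarrow> bool" where
  "smooth_jet F \<longleftrightarrow> (\<forall>n t. (F n has_real_derivative F (Suc n) t) (at t))"

text \<open>The functions \<open>p (1 / t) * exp (- 1 / t)\<close>, extended by zero, form a class that is closed under
differentiation, and it contains the standard function that is smooth but not analytic at the
origin.\<close>

definition flat :: "real poly \<Rightarrow> real \<Rightarrow> real" where
  "flat p t = (if 0 < t then poly p (1 / t) * exp (- (1 / t)) else 0)"

lemma poly_times_exp_minus_tendsto_0: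
  "((\<lambda>s::real. poly p s * exp (- s)) \<longlongrightarrow> 0) at_top"
proof -
  have "((\<lambda>s. \<Sum>i\<le>degree p. coeff p i * (s ^ i / exp s)) \<longlongrightarrow> (\<Sum>i\<le>degree p. coeff p i * 0)) at_top"
    by (intro tendsto_sum tendsto_mult tendsto_const tendsto_power_div_exp_0)
  then show ?thesis
    by (simp add: poly_altdef sum_divide_distrib exp_minus divide_inverse sum_distrib_right mult.assoc)
qed

lemma DERIV_flat:
  "(flat p has_real_derivative flat ([:0, 0, 1:] * (p - pderiv p)) t) (at t)"
proof -
  consider "t > 0" | "t < 0" | "t = 0" by linarith
  then show ?thesis
  proof cases
    case 1
    have "((\<lambda>t. poly p (1 / t) * exp (- (1 / t))) has_real_derivative
        flat ([:0, 0, 1:] * (p - pderiv p)) t) (at t)"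
      using 1 by (auto intro!: derivative_eq_intros simp: flat_def field_simps power2_eq_square)
    then show ?thesis
      by (rule has_field_derivative_transform_within_open[of _ _ _ "{0<..}"])
        (use 1 in \<open>auto simp: flat_def\<close>)
  next
    case 2
    have "((\<lambda>t. 0) has_real_derivative flat ([:0, 0, 1:] * (p - pderiv p)) t) (at t)"
      using 2 by (simp add: flat_def)
    then show ?thesis
      by (rule has_field_derivative_transform_within_open[of _ _ _ "{..<0}"])
        (use 2 in \<open>auto simp: flat_def\<close>)
  next
    case 3
    have "((\<lambda>h. poly ([:0, 1:] * p) (inverse h) * exp (- inverse h)) \<longlongrightarrow> 0) (at_right 0)"
      by (rule filterlim_compose[OF poly_times_exp_minus_tendsto_0 filterlim_inverse_at_top_right])
    then have "((\<lambda>h. flat p h / h) \<longlongrightarrow> 0) (at_right 0)"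
      by (rule Lim_transform_eventually)
        (auto simp: eventually_at_filter flat_def field_simps)
    moreover have "((\<lambda>h. flat p h / h) \<longlongrightarrow> 0) (at_left 0)"
      by (rule tendsto_eventually) (auto simp: eventually_at_filter flat_def)
    ultimately have "((\<lambda>h. flat p h / h) \<longlongrightarrow> 0) (at 0)"
      by (simp add: filterlim_at_split)
    then show ?thesis using 3 by (simp add: has_field_derivative_iff flat_def)
  qed
qed

definition flat_jet :: "nat \<Rightarrow> real \<Rightarrow> real" where
  "flat_jet n = flat (((\<lambda>p. [:0, 0, 1:] * (p - pderiv p)) ^^ n) 1)"

lemma smooth_flat_jet: "smooth_jet flat_jet"
  unfolding smooth_jet_def flat_jet_def using DERIV_flat by simp

lemma flat_jet_0: "flat_jet 0 t = (if 0 < t then exp (- (1 / t)) else 0)"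
  by (simp add: flat_jet_def flat_def)

lemma smooth_jet_affine:
  assumes "smooth_jet F"
  shows "smooth_jet (\<lambda>n t. c ^ n * F n (c * t + d))"
  unfolding smooth_jet_def
proof (intro allI)
  fix n t
  have F: "(F n has_real_derivative F (Suc n) (c * t + d)) (at (c * t + d))"
    using assms by (simp add: smooth_jet_def)
  have "((\<lambda>t. F n (c * t + d)) has_real_derivative F (Suc n) (c * t + d) * c) (at t)"
    by (rule DERIV_chain2[where g = "\<lambda>t. c * t + d", OF F]) (auto intro!: derivative_eq_intros)
  then show "((\<lambda>t. c ^ n * F n (c * t + d)) has_real_derivative c ^ Suc n * F (Suc n) (c * t + d)) (at t)"
    by (auto dest: DERIV_cmult[where c = "c ^ n"] simp: mult_ac)
qed

text \<open>The derivatives of a product by the Leibniz rule.\<close>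

definition jet_mult :: "(nat \<Rightarrow> real \<Rightarrow> real) \<Rightarrow> (nat \<Rightarrow> real \<Rightarrow> real) \<Rightarrow> nat \<Rightarrow> real \<Rightarrow> real" where
  "jet_mult F G n t = (\<Sum>k\<le>n. real (n choose k) * (F k t * G (n - k) t))"

lemma smooth_jet_mult:
  assumes "smooth_jet F" "smooth_jet G"
  shows "smooth_jet (jet_mult F G)"
  unfolding smooth_jet_def
proof (intro allI)
  fix n t
  have D: "(F k has_real_derivative F (Suc k) t) (at t)" "(G k has_real_derivative G (Suc k) t) (at t)" for k
    using assms by (auto simp: smooth_jet_def)
  let ?h = "\<lambda>k. F k t * G (Suc n - k) t"
  have "(jet_mult F G n has_real_derivative
      (\<Sum>k\<le>n. real (n choose k) * (F (Suc k) t * G (n - k) t + F k t * G (Suc (n - k)) t))) (at t)"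
    unfolding jet_mult_def[abs_def]
    by (intro DERIV_sum DERIV_cmult) (auto intro!: derivative_eq_intros D)
  moreover have "(\<Sum>k\<le>n. real (n choose k) * (F (Suc k) t * G (n - k) t + F k t * G (Suc (n - k)) t))
      = jet_mult F G (Suc n) t"
  proof -
    have "(\<Sum>k\<le>n. real (n choose k) * (F k t * G (Suc (n - k)) t)) = (\<Sum>k\<le>n. real (n choose k) * ?h k)"
      by (intro sum.cong) (auto simp: Suc_diff_le)
    also have "\<dots> = (\<Sum>k\<le>Suc n. real (n choose k) * ?h k)" by simp
    also have "\<dots> = ?h 0 + (\<Sum>k\<le>n. real (n choose Suc k) * ?h (Suc k))"
      by (subst sum.atMost_Suc_shift) simp
    finally show ?thesis
      unfolding jet_mult_def
      by (subst sum.atMost_Suc_shift) (simp add: ring_distribs sum.distrib)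
  qed
  ultimately show "(jet_mult F G n has_real_derivative jet_mult F G (Suc n) t) (at t)" by simp
qed

text \<open>For \<open>m > 0\<close> the function \<open>exp (- 1 / (m (t - a))) * exp (- 1 / (m (b - t)))\<close>, cut off outside the
interval from \<open>a\<close> to \<open>b\<close>. The parameter \<open>m\<close> steepens the flanks: as it grows, the bumps converge
to the indicator of the open interval and stay between 0 and 1.\<close>

definition bump_jet :: "real \<Rightarrow> real \<Rightarrow> real \<Rightarrow> nat \<Rightarrow> real \<Rightarrow> real" where
  "bump_jet m a b = jet_mult (\<lambda>n t. m ^ n * flat_jet n (m * t + - m * a))
     (\<lambda>n t. (- m) ^ n * flat_jet n (- m * t + m * b))"

lemma smooth_bump_jet: "smooth_jet (bump_jet m a b)"
  unfolding bump_jet_def by (intro smooth_jet_mult smooth_jet_affine smooth_flat_jet)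

lemma bump_jet_0: "bump_jet m a b 0 t = flat_jet 0 (m * (t - a)) * flat_jet 0 (m * (b - t))"
  by (simp add: bump_jet_def jet_mult_def algebra_simps)

lemma bump_jet_pos_iff: "0 < m \<Longrightarrow> 0 < bump_jet m a b 0 t \<longleftrightarrow> a < t \<and> t < b"
  and bump_jet_eq_0: "0 < m \<Longrightarrow> \<not> (a < t \<and> t < b) \<Longrightarrow> bump_jet m a b 0 t = 0"
  by (auto simp: bump_jet_0 flat_jet_0 zero_less_mult_iff)

lemma bump_jet_bounds: "0 \<le> bump_jet m a b 0 t" "bump_jet m a b 0 t \<le> 1"
  by (auto simp: bump_jet_0 flat_jet_0 intro!: mult_le_one)

lemma bump_jet_tendsto:
  "(\<lambda>n. bump_jet (real (Suc n)) a b 0 t) \<longlonglongrightarrow> (if a < t \<and> t < b then 1 else 0)"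
proof -
  have *: "(\<lambda>n. flat_jet 0 (real (Suc n) * s)) \<longlonglongrightarrow> (if 0 < s then 1 else 0)" for s
  proof (cases "0 < s")
    case True
    have "(\<lambda>n. exp (- (1 / s * inverse (real (Suc n))))) \<longlonglongrightarrow> exp (- (1 / s * 0))"
      by (intro tendsto_intros LIMSEQ_inverse_real_of_nat)
    then show ?thesis using True by (simp add: flat_jet_0 field_simps zero_less_mult_iff del: of_nat_Suc)
  next
    case False
    then show ?thesis by (simp add: flat_jet_0 zero_less_mult_iff del: of_nat_Suc)
  qed
  have "(\<lambda>n. bump_jet (real (Suc n)) a b 0 t) \<longlonglongrightarrow> (if 0 < t - a then 1 else 0) * (if 0 < b - t then 1 else 0)"
    unfolding bump_jet_0 by (intro tendsto_mult *)
  then show ?thesis by (simp split: if_splits)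
qed

text \<open>The partial derivative in the directions \<open>is\<close> of a product of functions of one coordinate each:
every factor is differentiated as often as its coordinate occurs in \<open>is\<close>.\<close>

definition tensor :: "('d \<Rightarrow> nat \<Rightarrow> real \<Rightarrow> real) \<Rightarrow> 'd::finite list \<Rightarrow> real^'d \<Rightarrow> real" where
  "tensor F is x = (\<Prod>i\<in>UNIV. F i (count_list is i) (x $ i))"

lemma GDERIV_tensor:
  assumes "\<And>i. smooth_jet (F i)"
  shows "GDERIV (tensor F is) x :> (\<chi> i. tensor F (i # is) x)"
proof -
  have "((\<lambda>x. F i (count_list is i) (x $ i)) has_derivative
      (\<lambda>h. F i (Suc (count_list is i)) (x $ i) * h $ i)) (at x)" for i
  proof -
    have "(F i (count_list is i) has_derivative (*) (F i (Suc (count_list is i)) (x $ i))) (at (x $ i))"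
      using assms unfolding smooth_jet_def has_field_derivative_def by blast
    then show ?thesis
      by (rule has_derivative_compose[rotated])
        (auto intro!: derivative_intros bounded_linear_imp_has_derivative bounded_linear_vec_nth)
  qed
  then have "(tensor F is has_derivative (\<lambda>h. \<Sum>i\<in>UNIV. (F i (Suc (count_list is i)) (x $ i) * h $ i) *
      (\<Prod>j\<in>UNIV - {i}. F j (count_list is j) (x $ j)))) (at x)"
    unfolding tensor_def[abs_def] by (rule has_derivative_prod)
  moreover have "tensor F (i # is) x =
      F i (Suc (count_list is i)) (x $ i) * (\<Prod>j\<in>UNIV - {i}. F j (count_list is j) (x $ j))" for i
    unfolding tensor_def by (subst prod.remove[of _ i]) (auto intro!: prod.cong)
  ultimately show ?thesis
    unfolding gderiv_def by (simp add: inner_vec_def mult_ac)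
qed

lemma test_function_tensor:
  assumes "\<And>i. smooth_jet (F i)" "\<And>i t. \<not> (a $ i \<le> t \<and> t \<le> b $ i) \<Longrightarrow> F i 0 t = 0" "cbox a b \<subseteq> \<Omega>"
  shows "test_function \<Omega> (tensor F [])"
  unfolding test_function_def
proof
  show "smooth (tensor F [])"
    unfolding smooth_def by (intro exI[of _ "tensor F"]) (simp add: GDERIV_tensor[OF assms(1)])
  have "tensor F [] x = 0" if "x \<notin> cbox a b" for x
    using that assms(2) unfolding tensor_def mem_box_cart by (auto intro!: prod_zero)
  then show "\<exists>K. compact K \<and> K \<subseteq> \<Omega> \<and> (\<forall>x. x \<notin> K \<longrightarrow> tensor F [] x = 0)"
    using assms(3) compact_cbox by blast
qed

definition bump :: "real \<Rightarrow> real^'d \<Rightarrow> real^'d \<Rightarrow> real^'d \<Rightarrow> real" where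
  "bump m a b = tensor (\<lambda>i. bump_jet m (a $ i) (b $ i)) []"

lemma bump_eq_prod: "bump m a b x = (\<Prod>i\<in>UNIV. bump_jet m (a $ i) (b $ i) 0 (x $ i))"
  by (simp add: bump_def tensor_def)

lemma test_function_bump: "0 < m \<Longrightarrow> cbox a b \<subseteq> \<Omega> \<Longrightarrow> test_function \<Omega> (bump m a b)"
  unfolding bump_def by (rule test_function_tensor) (auto intro: smooth_bump_jet bump_jet_eq_0)

lemma bump_bounds: "0 \<le> bump m a b x" "bump m a b x \<le> 1"
  by (auto simp: bump_eq_prod bump_jet_bounds intro!: prod_nonneg prod_le_1)

lemma bump_pos: "0 < m \<Longrightarrow> x \<in> box a b \<Longrightarrow> 0 < bump m a b x"
  by (auto simp: bump_eq_prod mem_box_cart bump_jet_pos_iff intro!: prod_pos)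

lemma bump_eq_0: "0 < m \<Longrightarrow> x \<notin> box a b \<Longrightarrow> bump m a b x = 0"
  by (auto simp: bump_eq_prod mem_box_cart intro!: prod_zero bump_jet_eq_0)

lemma bump_tendsto: "(\<lambda>n. bump (real (Suc n)) a b x) \<longlonglongrightarrow> indicator (box a b) x"
proof -
  have "(\<lambda>n. bump (real (Suc n)) a b x) \<longlonglongrightarrow> (\<Prod>i\<in>UNIV. if a $ i < x $ i \<and> x $ i < b $ i then 1 else 0)"
    unfolding bump_eq_prod by (intro tendsto_prod bump_jet_tendsto)
  also have "(\<Prod>i\<in>UNIV. if a $ i < x $ i \<and> x $ i < b $ i then 1 else 0) = (indicator (box a b) x :: real)"
    by (auto simp: indicator_def mem_box_cart intro!: prod_zero)
  finally show ?thesis .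
qed

section \<open>Integrals against test functions\<close>

lemma test_function_gradient:
  fixes \<psi> :: "real^'d \<Rightarrow> real"
  assumes "test_function \<Omega> \<psi>" and D: "\<And>x. GDERIV \<psi> x :> \<psi>' x"
  obtains K C where "compact K" "K \<subseteq> \<Omega>" "continuous_on UNIV \<psi>" "continuous_on UNIV \<psi>'"
    "\<And>x. x \<notin> K \<Longrightarrow> \<psi> x = 0" "\<And>x. x \<notin> K \<Longrightarrow> \<psi>' x = 0"
    "\<And>x. \<bar>\<psi> x\<bar> \<le> C" "\<And>x. norm (\<psi>' x) \<le> C"
proof -
  obtain E K where E: "E [] = \<psi>" "\<And>is x. GDERIV (E is) x :> (\<chi> i. E (i # is) x)"
    and K: "compact K" "K \<subseteq> \<Omega>" "\<And>x. x \<notin> K \<Longrightarrow> \<psi> x = 0"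
    using assms(1) unfolding test_function_def smooth_def by blast
  have unique: "g = h" if "GDERIV \<psi> x :> g" "GDERIV \<psi> x :> h" for g h x
    using has_derivative_unique[OF that[unfolded gderiv_def]] by (metis vector_eq_ldot)
  have \<psi>': "\<psi>' = (\<lambda>x. \<chi> i. E [i] x)"
    using unique[OF D] E(2)[of "[]"] E(1) by (intro ext) metis
  have cont: "continuous_on UNIV (E is)" for "is"
    using E(2)[of "is"] by (intro continuous_at_imp_continuous_on) (auto simp: gderiv_def intro: has_derivative_continuous)
  have c1: "continuous_on UNIV \<psi>" using cont[of "[]"] E(1) by simp
  have c2: "continuous_on UNIV \<psi>'" unfolding \<psi>' by (intro continuous_on_vec_lambda cont)
  have 0: "\<psi>' x = 0" if "x \<notin> K" for x
  proof -
    have "((\<lambda>x. 0) has_derivative (\<lambda>h. h \<bullet> (0::real^'d))) (at x)" by simp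
    then have "(\<psi> has_derivative (\<lambda>h. h \<bullet> 0)) (at x)"
      by (rule has_derivative_transform_within_open[of _ _ _ _ "- K"])
        (use K that in \<open>auto intro: compact_imp_closed\<close>)
    then show ?thesis by (intro unique[OF D]) (simp add: gderiv_def)
  qed
  have "bounded (\<psi> ` K)" "bounded (\<psi>' ` K)"
    using K(1) c1 c2 by (meson compact_continuous_image compact_imp_bounded continuous_on_subset top_greatest)+
  then obtain B1 B2 where "\<forall>y\<in>\<psi> ` K. norm y \<le> B1" "\<forall>y\<in>\<psi>' ` K. norm y \<le> B2"
    unfolding bounded_iff by blast
  then have B: "\<And>x. x \<in> K \<Longrightarrow> norm (\<psi> x) \<le> B1" "\<And>x. x \<in> K \<Longrightarrow> norm (\<psi>' x) \<le> B2"
    by auto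
  show ?thesis
  proof
    show "\<bar>\<psi> x\<bar> \<le> max 0 (max B1 B2)" "norm (\<psi>' x) \<le> max 0 (max B1 B2)" for x
      using B[of x] K(3)[of x] 0[of x] by (cases "x \<in> K"; force)+
  qed (use K c1 c2 0 in auto)
qed

lemma integral_lebesgue_on_eq_lborel:
  fixes f g :: "real^'d \<Rightarrow> 'b::euclidean_space"
  assumes "\<Omega> \<in> sets lebesgue" "g \<in> borel_measurable borel"
    and "\<And>x. x \<in> \<Omega> \<Longrightarrow> f x = g x" "\<And>x. x \<notin> \<Omega> \<Longrightarrow> g x = 0"
  shows "(LINT x|lebesgue_on \<Omega>. f x) = (LINT x|lborel. g x)"
proof -
  have "(LINT x|lebesgue_on \<Omega>. f x) = (LINT x|lebesgue. (if x \<in> \<Omega> then f x else 0))"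
    using assms(1) by (simp add: Lebesgue_Measure.integral_restrict_UNIV)
  also have "(\<lambda>x. if x \<in> \<Omega> then f x else 0) = g" using assms by auto
  finally show ?thesis using assms(2) by (simp add: integral_completion)
qed

lemma integral_lborel_translate:
  fixes f :: "'a::euclidean_space \<Rightarrow> 'b::euclidean_space"
  assumes "f \<in> borel_measurable borel"
  shows "(LINT x|lborel. f (c + x)) = (LINT x|lborel. f x)"
  using integral_distr[of "(+) c" lborel borel f] assms by (simp add: lborel_distr_plus)

lemma integrable_compact_support:
  fixes f :: "'a::euclidean_space \<Rightarrow> 'b::{banach, second_countable_topology}"
  assumes "compact K" "continuous_on UNIV f" "\<And>x. x \<notin> K \<Longrightarrow> f x = 0"
  shows "integrable lborel f"
proof -
  have "integrable lborel (\<lambda>x. indicator K x *\<^sub>R f x)"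
    using assms by (intro borel_integrable_compact) (auto intro: continuous_on_subset)
  also have "(\<lambda>x. indicator K x *\<^sub>R f x) = f"
    using assms(3) by (auto simp: indicator_def)
  finally show ?thesis .
qed

text \<open>Difference quotients of a function with compact support have integral zero by translation
invariance of the Lebesgue measure. They converge boundedly to the directional derivative.\<close>

lemma integral_directional_derivative_eq_0:
  fixes \<psi> :: "'a::euclidean_space \<Rightarrow> real"
  assumes K: "compact K" "\<And>x. x \<notin> K \<Longrightarrow> \<psi> x = 0" "\<And>x. x \<notin> K \<Longrightarrow> \<psi>' x = 0"
    and cont: "continuous_on UNIV \<psi>" "continuous_on UNIV \<psi>'"
    and C: "\<And>x. norm (\<psi>' x) \<le> C"
    and D: "\<And>x. GDERIV \<psi> x :> \<psi>' x" and e: "norm e = 1"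
  shows "(LINT x|lborel. e \<bullet> \<psi>' x) = 0"
proof -
  obtain R where R: "K \<subseteq> cball 0 R"
    using compact_imp_bounded[OF K(1)] unfolding bounded_iff by (metis mem_cball_0 subsetI)
  have der: "((\<lambda>t. \<psi> (x + t *\<^sub>R e)) has_real_derivative e \<bullet> \<psi>' (x + t *\<^sub>R e)) (at t)" for x t
  proof -
    have "((\<lambda>t. \<psi> (x + t *\<^sub>R e)) has_derivative (\<lambda>h. (h *\<^sub>R e) \<bullet> \<psi>' (x + t *\<^sub>R e))) (at t)"
      by (rule has_derivative_compose[where g = \<psi>, OF _ D[unfolded gderiv_def]])
        (auto intro!: derivative_eq_intros)
    then show ?thesis unfolding has_field_derivative_def by (simp add: mult_commute_abs)
  qed
  let ?q = "\<lambda>n x. real (Suc n) * (\<psi> (x + (1 / real (Suc n)) *\<^sub>R e) - \<psi> x)"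
  have meas: "(\<lambda>x. \<psi> (x + c)) \<in> borel_measurable borel" for c
    by (intro borel_measurable_continuous_onI continuous_on_compose2[OF cont(1), of UNIV "\<lambda>x. x + c"])
      (auto intro!: continuous_intros)
  have int: "integrable lborel \<psi>"
    by (rule integrable_compact_support[OF K(1) cont(1) K(2)])
  have int': "integrable lborel (\<lambda>x. \<psi> (x + c))" for c
    using integrable_distr_eq[of "(+) c" lborel borel \<psi>] int meas[of 0] by (simp add: lborel_distr_plus add.commute)
  have "(\<lambda>n. LINT x|lborel. ?q n x) \<longlonglongrightarrow> (LINT x|lborel. e \<bullet> \<psi>' x)"
  proof (rule integral_dominated_convergence)
    show "(\<lambda>x. e \<bullet> \<psi>' x) \<in> borel_measurable lborel"
      using cont(2) by (auto intro!: borel_measurable_continuous_onI continuous_intros)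
    show "?q n \<in> borel_measurable lborel" for n
      using meas[of 0] meas[of "(1 / real (Suc n)) *\<^sub>R e"] by (simp del: of_nat_Suc)
    show "integrable lborel (\<lambda>x. C * indicator (cball 0 (R + 1)) x :: real)"
      by (intro integrable_mult_right integrable_real_indicator emeasure_compact_finite) auto
    show "AE x in lborel. (\<lambda>n. ?q n x) \<longlonglongrightarrow> e \<bullet> \<psi>' x"
    proof (rule AE_I2)
      fix x
      have "((\<lambda>h. (\<psi> (x + h *\<^sub>R e) - \<psi> x) / h) \<longlongrightarrow> e \<bullet> \<psi>' x) (at 0)"
        using der[of x 0] by (simp add: has_field_derivative_iff)
      moreover have "filterlim (\<lambda>n. 1 / real (Suc n)) (at 0) sequentially"
        using LIMSEQ_inverse_real_of_nat by (simp add: filterlim_at inverse_eq_divide del: of_nat_Suc)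
      ultimately have "(\<lambda>n. (\<psi> (x + (1 / real (Suc n)) *\<^sub>R e) - \<psi> x) / (1 / real (Suc n))) \<longlonglongrightarrow> e \<bullet> \<psi>' x"
        by (rule filterlim_compose)
      then show "(\<lambda>n. ?q n x) \<longlonglongrightarrow> e \<bullet> \<psi>' x" by (simp add: mult.commute)
    qed
    show "AE x in lborel. norm (?q n x) \<le> C * indicator (cball 0 (R + 1)) x" for n
    proof (rule AE_I2)
      fix x
      let ?h = "1 / real (Suc n)"
      have h: "0 < ?h" "?h \<le> 1" by auto
      obtain z where "\<psi> (x + ?h *\<^sub>R e) - \<psi> (x + 0 *\<^sub>R e) = (?h - 0) * (e \<bullet> \<psi>' (x + z *\<^sub>R e))"
        using MVT2[OF h(1), of "\<lambda>t. \<psi> (x + t *\<^sub>R e)" "\<lambda>t. e \<bullet> \<psi>' (x + t *\<^sub>R e)"] der by blast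
      then have q: "?q n x = e \<bullet> \<psi>' (x + z *\<^sub>R e)" by simp
      show "norm (?q n x) \<le> C * indicator (cball 0 (R + 1)) x"
      proof (cases "x \<in> cball 0 (R + 1)")
        case True
        have "norm (e \<bullet> \<psi>' (x + z *\<^sub>R e)) \<le> norm e * norm (\<psi>' (x + z *\<^sub>R e))"
          by (simp add: Cauchy_Schwarz_ineq2)
        then show ?thesis unfolding q using True C[of "x + z *\<^sub>R e"] e by simp
      next
        case False
        have "norm x \<le> norm (x + ?h *\<^sub>R e) + norm (?h *\<^sub>R e)"
          by (metis add_diff_cancel_right' norm_triangle_ineq4)
        moreover have "norm (?h *\<^sub>R e) \<le> 1" "R + 1 < norm x"
          using False h e by auto
        ultimately have "norm (x + ?h *\<^sub>R e) > R" by linarith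
        then have "x + ?h *\<^sub>R e \<notin> K" "x \<notin> K" using R False by auto
        then show ?thesis using False K(2) by (simp del: of_nat_Suc)
      qed
    qed
  qed
  moreover have "(LINT x|lborel. ?q n x) = 0" for n
    using int'[of "(1 / real (Suc n)) *\<^sub>R e"] int'[of 0] meas[of 0]
      integral_lborel_translate[of \<psi> "(1 / real (Suc n)) *\<^sub>R e"]
    by (simp add: add.commute del: of_nat_Suc)
  ultimately show ?thesis
    using LIMSEQ_unique tendsto_const by (metis (no_types, lifting) ext)
qed

lemma integral_test_gradient_eq_0:
  fixes \<psi> :: "real^'d \<Rightarrow> real"
  assumes "\<Omega> \<in> sets lebesgue" "test_function \<Omega> \<psi>" and D: "\<And>x. GDERIV \<psi> x :> \<psi>' x"
  shows "(LINT x|lebesgue_on \<Omega>. \<psi>' x) = 0"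
proof -
  obtain K C where K: "compact K" "K \<subseteq> \<Omega>" and cont: "continuous_on UNIV \<psi>" "continuous_on UNIV \<psi>'"
    and z: "\<And>x. x \<notin> K \<Longrightarrow> \<psi> x = 0" "\<And>x. x \<notin> K \<Longrightarrow> \<psi>' x = 0" and C: "\<And>x. norm (\<psi>' x) \<le> C"
    using test_function_gradient[OF assms(2) D] by metis
  have "(LINT x|lebesgue_on \<Omega>. \<psi>' x) = (LINT x|lborel. \<psi>' x)"
    using K z assms(1) cont(2)
    by (intro integral_lebesgue_on_eq_lborel borel_measurable_continuous_onI) auto
  also have "\<dots> = 0"
  proof (rule euclidean_eqI)
    fix b :: "real^'d" assume b: "b \<in> Basis"
    have "integrable lborel \<psi>'"
      by (rule integrable_compact_support[OF K(1) cont(2) z(2)])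
    then show "(LINT x|lborel. \<psi>' x) \<bullet> b = 0 \<bullet> b"
      using integral_directional_derivative_eq_0[OF K(1) z cont C D, of b] b
      by (simp add: inner_commute)
  qed
  finally show ?thesis .
qed

lemma continuous_bump: "0 < m \<Longrightarrow> continuous_on UNIV (bump m a b)"
  using test_function_bump[of m a b UNIV]
  unfolding test_function_def smooth_def
  by (metis continuous_at_imp_continuous_on gderiv_def has_derivative_continuous subset_UNIV)

section \<open>The fundamental lemma of the calculus of variations\<close>

lemma integrable_lebesgue_on_subset:
  fixes f :: "'a::euclidean_space \<Rightarrow> 'b::{banach, second_countable_topology}"
  assumes "integrable (lebesgue_on T) f" "S \<subseteq> T" "S \<in> sets lebesgue" "T \<in> sets lebesgue"
  shows "integrable (lebesgue_on S) f"
proof -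
  have "set_integrable lebesgue T f"
    using assms by (simp add: integrable_restrict_space set_integrable_def)
  then have "set_integrable lebesgue S f"
    using assms by (blast intro: set_integrable_subset)
  then show ?thesis
    using assms by (simp add: integrable_restrict_space set_integrable_def)
qed

text \<open>Dominated convergence, as bumps with growing steepness converge to the indicator of the box.\<close>

lemma integral_box_eq_0_if_orthogonal_to_bumps:
  fixes g :: "real^'d \<Rightarrow> 'b::euclidean_space"
  assumes int: "integrable (lebesgue_on \<Omega>) g" and \<Omega>: "\<Omega> \<in> sets lebesgue"
    and bumps: "\<And>m. 0 < m \<Longrightarrow> (LINT x|lebesgue_on \<Omega>. bump m a b x *\<^sub>R g x) = 0"
  shows "(LINT x|lebesgue_on \<Omega>. indicator (box a b) x *\<^sub>R g x) = 0"
proof -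
  have meas: "bump m a b \<in> borel_measurable (lebesgue_on \<Omega>)" if "0 < m" for m
    using continuous_imp_measurable_on_sets_lebesgue[OF continuous_on_subset[OF continuous_bump[OF that]]] \<Omega> by blast
  have "(\<lambda>n. LINT x|lebesgue_on \<Omega>. bump (real (Suc n)) a b x *\<^sub>R g x)
      \<longlonglongrightarrow> (LINT x|lebesgue_on \<Omega>. indicator (box a b) x *\<^sub>R g x)"
  proof (rule integral_dominated_convergence)
    have "box a b \<inter> \<Omega> \<in> sets (lebesgue_on \<Omega>)"
      using \<Omega> by (auto simp: sets_restrict_space_iff)
    then have "indicat_real (box a b) \<in> borel_measurable (lebesgue_on \<Omega>)"
      by (auto simp: borel_measurable_indicator_iff space_restrict_space)
    then show "(\<lambda>x. indicat_real (box a b) x *\<^sub>R g x) \<in> borel_measurable (lebesgue_on \<Omega>)"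
      using int by (intro borel_measurable_scaleR) auto
    show "(\<lambda>x. bump (real (Suc n)) a b x *\<^sub>R g x) \<in> borel_measurable (lebesgue_on \<Omega>)" for n
      using int meas[of "real (Suc n)"] by (intro borel_measurable_scaleR) auto
    show "integrable (lebesgue_on \<Omega>) (\<lambda>x. norm (g x))" using int by simp
    show "AE x in lebesgue_on \<Omega>. (\<lambda>n. bump (real (Suc n)) a b x *\<^sub>R g x) \<longlonglongrightarrow> indicator (box a b) x *\<^sub>R g x"
      by (intro AE_I2 tendsto_scaleR bump_tendsto tendsto_const)
    show "AE x in lebesgue_on \<Omega>. norm (bump (real (Suc n)) a b x *\<^sub>R g x) \<le> norm (g x)" for n
      using bump_bounds[of "real (Suc n)" a b] by (intro AE_I2) (auto intro!: mult_left_le_one_le simp del: of_nat_Suc)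
  qed
  then show ?thesis
    using bumps LIMSEQ_unique[OF _ tendsto_const[of 0]] by (simp del: of_nat_Suc)
qed

text \<open>By Lebesgue differentiation, \<open>h\<close> is almost everywhere the limit of its averages over small boxes,
and these averages vanish.\<close>

lemma AE_eq_0_on_cbox:
  fixes h :: "real^'d \<Rightarrow> 'b::euclidean_space"
  assumes int: "integrable (lebesgue_on \<Omega>) h" and \<Omega>: "\<Omega> \<in> sets lebesgue" and Q: "cbox p q \<subseteq> \<Omega>"
    and boxes: "\<And>a b. cbox a b \<subseteq> cbox p q \<Longrightarrow> (LINT x|lebesgue_on \<Omega>. indicator (box a b) x *\<^sub>R h x) = 0"
  shows "negligible {x \<in> cbox p q. h x \<noteq> 0}"
proof -
  have 0: "(h has_integral 0) (cbox a b)" if sub: "cbox a b \<subseteq> cbox p q" for a b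
  proof -
    have ab: "box a b \<subseteq> \<Omega>" using sub Q box_subset_cbox by blast
    have "integrable (lebesgue_on (box a b)) h"
      using int \<Omega> ab by (auto intro: integrable_lebesgue_on_subset)
    moreover have "(LINT x|lebesgue_on (box a b). h x) = 0"
    proof -
      have "(LINT x|lebesgue_on (box a b). h x) = (LINT x|lebesgue_on \<Omega>. (if x \<in> box a b then h x else 0))"
        using ab \<Omega> by (subst integral_restrict) auto
      then show ?thesis using boxes[OF sub] by (simp add: indicator_scaleR_eq_if)
    qed
    ultimately have "(h has_integral 0) (box a b)"
      using has_integral_integral_lebesgue_on[of "box a b" h] by simp
    then show ?thesis by (simp add: has_integral_open_interval)
  qed
  define f where "f x = (if x \<in> cbox p q then h x else 0)" for x
  have f0: "(f has_integral 0) (cbox a b)" for a b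
  proof -
    obtain c d where cd: "cbox a b \<inter> cbox p q = cbox c d" by (meson Int_interval)
    have "(h has_integral 0) (cbox p q \<inter> cbox a b)" using 0[of c d] cd by (metis Int_commute Int_lower2)
    then show ?thesis unfolding f_def by (subst has_integral_restrict_Int) (simp add: Int_commute)
  qed
  obtain N where N: "negligible N" and
    lim: "\<And>x e. x \<notin> N \<Longrightarrow> 0 < e \<Longrightarrow> \<exists>d>0. \<forall>h. 0 < h \<and> h < d \<longrightarrow>
        norm (integral (cbox x (x + h *\<^sub>R One)) f /\<^sub>R h ^ DIM(real^'d) - f x) < e"
    using integrable_ccontinuous_explicit[of f] f0 by (metis has_integral_integrable)
  have "f x = 0" if x: "x \<notin> N" for x
  proof (rule ccontr)
    assume "f x \<noteq> 0"
    then obtain d where "d > 0" "\<forall>h. 0 < h \<and> h < d \<longrightarrow>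
        norm (integral (cbox x (x + h *\<^sub>R One)) f /\<^sub>R h ^ DIM(real^'d) - f x) < norm (f x)"
      using lim[OF x, of "norm (f x)"] by auto
    then have "norm (integral (cbox x (x + (d / 2) *\<^sub>R One)) f /\<^sub>R (d / 2) ^ DIM(real^'d) - f x) < norm (f x)"
      by auto
    then show False using integral_unique[OF f0] by simp
  qed
  then have "x \<in> N" if "x \<in> cbox p q" "h x \<noteq> 0" for x
    using that by (fastforce simp: f_def)
  then have "{x \<in> cbox p q. h x \<noteq> 0} \<subseteq> N" by blast
  then show ?thesis using N negligible_subset by blast
qed

lemma AE_eq_0_if_orthogonal_to_bumps:
  fixes g :: "real^'d \<Rightarrow> 'b::euclidean_space"
  assumes int: "integrable (lebesgue_on \<Omega>) g" and \<Omega>: "\<Omega> \<in> sets lebesgue"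
    and U: "open U" "U \<subseteq> \<Omega>"
    and bumps: "\<And>m a b. 0 < m \<Longrightarrow> cbox a b \<subseteq> U \<Longrightarrow> (LINT x|lebesgue_on \<Omega>. bump m a b x *\<^sub>R g x) = 0"
  shows "AE x in lebesgue_on \<Omega>. x \<in> U \<longrightarrow> g x = 0"
proof -
  obtain D where D: "countable D" "D \<subseteq> Pow U" "\<And>X. X \<in> D \<Longrightarrow> \<exists>a b. X = cbox a b" "\<Union>D = U"
    using open_countable_Union_open_cbox[OF U(1)] by metis
  have "negligible {x \<in> X. g x \<noteq> 0}" if X: "X \<in> D" for X
  proof -
    obtain p q where pq: "X = cbox p q" using D(3)[OF X] by blast
    have "cbox p q \<subseteq> U" using D(2) X pq by blast
    then show ?thesis unfolding pq
      using U by (intro AE_eq_0_on_cbox[OF int \<Omega>] integral_box_eq_0_if_orthogonal_to_bumps[OF int \<Omega>] bumps) auto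
  qed
  then have "negligible (\<Union>X\<in>D. {x \<in> X. g x \<noteq> 0})"
    using D(1) by (intro negligible_countable_Union) auto
  moreover have "(\<Union>X\<in>D. {x \<in> X. g x \<noteq> 0}) = {x \<in> U. g x \<noteq> 0}" using D(4) by blast
  ultimately have "{x \<in> U. g x \<noteq> 0} \<in> null_sets lebesgue" by (simp add: negligible_iff_null_sets)
  then have "AE x in lebesgue. x \<notin> {x \<in> U. g x \<noteq> 0}" by (rule AE_not_in)
  then show ?thesis using \<Omega> by (auto simp: AE_restrict_space_iff elim: eventually_mono)
qed

section \<open>Functions with vanishing weak gradient\<close>

text \<open>The difference of a bump and its translate has integral zero, so it is the derivative of a
smooth function with compact support.\<close>

lemma jet_of_translation_difference:
  assumes h: "0 < h"
  obtains \<eta> where "smooth_jet \<eta>"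
    "\<And>t. \<eta> (Suc 0) t = bump_jet 1 a b 0 t - bump_jet 1 a b 0 (t - h)"
    "\<And>t. \<not> (a \<le> t \<and> t \<le> b + h) \<Longrightarrow> \<eta> 0 t = 0"
proof -
  let ?\<rho> = "bump_jet 1 a b"
  have \<rho>: "(?\<rho> n has_real_derivative ?\<rho> (Suc n) t) (at t)" for n t
    using smooth_bump_jet unfolding smooth_jet_def by blast
  then have "isCont (?\<rho> 0) t" for t using DERIV_isCont by blast
  then obtain P where P: "\<And>t. (P has_real_derivative ?\<rho> 0 t) (at t)"
    using einterval_antiderivative[of "-\<infinity>" "\<infinity>" "?\<rho> 0"]
    by (auto simp: has_real_derivative_iff_has_vector_derivative)
  define Q where "Q = case_nat P ?\<rho>"
  have Q: "smooth_jet Q"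
    unfolding smooth_jet_def Q_def using P \<rho> by (auto split: nat.split)
  have Q': "smooth_jet (\<lambda>n t. Q n (t - h))"
    using smooth_jet_affine[OF Q, of 1 "- h"] by simp
  have const: "P s = P t" if "convex S" "s \<in> S" "t \<in> S" "\<And>x. x \<in> S \<Longrightarrow> ?\<rho> 0 x = 0" for s t S
  proof -
    have "\<exists>c. \<forall>x\<in>S. P x = c"
      by (rule has_field_derivative_zero_constant[OF that(1)])
        (use P that(4) in \<open>metis has_field_derivative_at_within\<close>)
    then show ?thesis using that by auto
  qed
  show ?thesis
  proof (rule that[of "\<lambda>n t. Q n t - Q n (t - h)"])
    show "smooth_jet (\<lambda>n t. Q n t - Q n (t - h))"
      using Q Q' unfolding smooth_jet_def by (intro allI DERIV_diff) auto
    show "Q 0 t - Q 0 (t - h) = 0" if t: "\<not> (a \<le> t \<and> t \<le> b + h)" for t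
    proof (cases "t < a")
      case True
      then have "P t = P (t - h)"
        using h by (intro const[of "{..a}"]) (auto intro: bump_jet_eq_0)
      then show ?thesis by (simp add: Q_def)
    next
      case False
      then have "P t = P (t - h)"
        using h t by (intro const[of "{b..}"]) (auto intro: bump_jet_eq_0)
      then show ?thesis by (simp add: Q_def)
    qed
  qed (simp add: Q_def)
qed

lemma test_function_translation_difference:
  fixes a b :: "real^'d"
  assumes "0 < h"
  obtains \<psi> \<psi>' where "test_function (cbox a (b + h *\<^sub>R axis i 1)) \<psi>" "\<And>x. GDERIV \<psi> x :> \<psi>' x"
    "\<And>x. \<psi>' x $ i = bump 1 a b x - bump 1 a b (x - h *\<^sub>R axis i 1)"
proof -
  obtain \<eta> where \<eta>: "smooth_jet \<eta>"
    "\<And>t. \<eta> (Suc 0) t = bump_jet 1 (a $ i) (b $ i) 0 t - bump_jet 1 (a $ i) (b $ i) 0 (t - h)"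
    "\<And>t. \<not> (a $ i \<le> t \<and> t \<le> b $ i + h) \<Longrightarrow> \<eta> 0 t = 0"
    using jet_of_translation_difference[OF assms] by metis
  define F where "F j = (if j = i then \<eta> else bump_jet 1 (a $ j) (b $ j))" for j
  have F: "smooth_jet (F j)" for j
    using \<eta>(1) smooth_bump_jet by (simp add: F_def)
  show ?thesis
  proof
    show "test_function (cbox a (b + h *\<^sub>R axis i 1)) (tensor F [])"
      by (rule test_function_tensor[OF F]) (auto simp: F_def axis_def intro: \<eta>(3) bump_jet_eq_0)
    show "GDERIV (tensor F []) x :> (\<chi> i. tensor F [i] x)" for x
      by (rule GDERIV_tensor[OF F])
    fix x
    let ?P = "\<lambda>x. \<Prod>j\<in>UNIV - {i}. bump_jet 1 (a $ j) (b $ j) 0 (x $ j)"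
    have "?P (x - h *\<^sub>R axis i 1) = ?P x"
      by (intro prod.cong) (auto simp: axis_def)
    moreover have "bump 1 a b y = bump_jet 1 (a $ i) (b $ i) 0 (y $ i) * ?P y" for y
      unfolding bump_eq_prod by (subst prod.remove[of _ i]) auto
    moreover have "tensor F [i] x = \<eta> (Suc 0) (x $ i) * ?P x"
      unfolding tensor_def by (subst prod.remove[of _ i]) (auto simp: F_def intro!: prod.cong)
    ultimately show "(\<chi> i. tensor F [i] x) $ i = bump 1 a b x - bump 1 a b (x - h *\<^sub>R axis i 1)"
      by (simp add: \<eta>(2) left_diff_distrib axis_def)
  qed
qed

text \<open>Testing with a function whose \<open>i\<close>-th partial derivative is a bump minus its translate shows that
\<open>u\<close> and its translate have the same integral against every small bump. If the values of the
continuous function \<open>u\<close> at \<open>x\<close> and at the translate of \<open>x\<close> differed, a bump close to \<open>x\<close> would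
tell them apart. This replaces mollification.\<close>

lemma zero_weak_gradient_translation_invariant:
  fixes u :: "real^'d \<Rightarrow> real"
  assumes u: "continuous_on \<Omega> u" and \<Omega>: "open \<Omega>"
    and zero: "has_weak_gradient u (\<lambda>x. 0) \<Omega>"
    and pq: "cbox p q \<subseteq> \<Omega>" "x \<in> box p q" "x + h *\<^sub>R axis i 1 \<in> box p q" and h: "0 < h"
  shows "u (x + h *\<^sub>R axis i 1) = u x"
proof (rule ccontr)
  assume neq: "u (x + h *\<^sub>R axis i 1) \<noteq> u x"
  let ?e = "h *\<^sub>R axis i 1 :: real^'d"
  let ?\<delta> = "\<lambda>y. u y - u (y + ?e)"
  \<comment> \<open>On the box from \<open>a\<close> to \<open>b\<close> obtained below, the
    difference \<open>?\<delta>\<close> keeps the sign it has at \<open>x\<close>.\<close>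
  let ?S = "box p q \<inter> (\<lambda>y. y + ?e) -` box p q"
  have S: "open ?S" by (intro open_Int open_vimage continuous_intros) auto
  have up: "continuous_on (cbox p q) u" using u pq continuous_on_subset by blast
  have "continuous_on ?S (\<lambda>y. u (y + ?e))"
    by (rule continuous_on_compose2[OF up])
      (auto intro!: continuous_intros simp: box_subset_cbox[THEN subsetD])
  moreover have "continuous_on ?S u"
    by (rule continuous_on_subset[OF up]) (auto simp: box_subset_cbox[THEN subsetD])
  ultimately have "continuous_on ?S (\<lambda>y. ?\<delta> x * ?\<delta> y)"
    by (intro continuous_intros)
  then have "open (?S \<inter> (\<lambda>y. ?\<delta> x * ?\<delta> y) -` {0<..})"
    by (intro continuous_open_preimage S) auto
  moreover have "x \<in> ?S \<inter> (\<lambda>y. ?\<delta> x * ?\<delta> y) -` {0<..}"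
    using neq pq by (auto simp: zero_less_mult_iff)
  ultimately obtain a b where ab: "cbox a b \<subseteq> ?S \<inter> (\<lambda>y. ?\<delta> x * ?\<delta> y) -` {0<..}" "x \<in> box a b"
    by (meson open_contains_cbox)
  have "a \<in> cbox a b" "b \<in> cbox a b" using ab(2) by (auto simp: mem_box_cart intro: less_imp_le less_trans)
  then have "a \<in> box p q" "b + ?e \<in> box p q" using ab(1) by auto
  then have corners: "p $ j < a $ j" "(b + ?e) $ j < q $ j" for j by (simp_all add: mem_box_cart)
  have sub: "cbox a (b + ?e) \<subseteq> cbox p q"
  proof
    fix z assume z: "z \<in> cbox a (b + ?e)"
    have "p $ j \<le> z $ j \<and> z $ j \<le> q $ j" for j
    proof -
      have "a $ j \<le> z $ j" "z $ j \<le> (b + ?e) $ j" using z by (simp_all add: mem_box_cart)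
      then show ?thesis using corners[of j] by linarith
    qed
    then show "z \<in> cbox p q" by (simp add: mem_box_cart)
  qed
  obtain \<psi> \<psi>' where \<psi>: "test_function (cbox a (b + ?e)) \<psi>" and D: "\<And>x. GDERIV \<psi> x :> \<psi>' x"
    and \<psi>': "\<And>x. \<psi>' x $ i = bump 1 a b x - bump 1 a b (x - ?e)"
    using test_function_translation_difference[OF h] by metis
  obtain K where K: "K \<subseteq> cbox a (b + ?e)" "\<And>y. y \<notin> K \<Longrightarrow> \<psi>' y = 0" and cont: "continuous_on UNIV \<psi>'"
    using test_function_gradient[OF \<psi> D] by metis
  have "test_function \<Omega> \<psi>"
    using \<psi> sub pq(1) unfolding test_function_def by (meson order_trans)
  then have "(LINT y|lebesgue_on \<Omega>. u y *\<^sub>R \<psi>' y) = 0"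
    using zero D unfolding has_weak_gradient_def scaleR_zero_right integral_zero minus_zero by blast
  let ?R = "bump 1 a b"
  define v where "v y = (if y \<in> cbox p q then u y else 0)" for y
  have v: "v \<in> borel_measurable borel"
    unfolding v_def by (intro borel_measurable_continuous_on_if up) auto
  have int: "integrable lborel (\<lambda>y. v y *\<^sub>R f y)" if "continuous_on UNIV f"
    for f :: "real^'d \<Rightarrow> 'c::euclidean_space"
  proof -
    have "integrable lborel (\<lambda>y. indicator (cbox p q) y *\<^sub>R (u y *\<^sub>R f y))"
      by (intro borel_integrable_compact continuous_intros up continuous_on_subset[OF that]) auto
    also have "(\<lambda>y. indicator (cbox p q) y *\<^sub>R (u y *\<^sub>R f y)) = (\<lambda>y. v y *\<^sub>R f y)"
      by (auto simp: v_def indicator_def)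
    finally show ?thesis .
  qed
  have R: "continuous_on UNIV ?R" by (rule continuous_bump) simp
  then have R': "continuous_on UNIV (\<lambda>y. ?R (y - ?e))"
    by (rule continuous_on_compose2) (auto intro!: continuous_intros)
  have "(LINT y|lborel. v y *\<^sub>R \<psi>' y) = 0"
  proof -
    have "(LINT y|lebesgue_on \<Omega>. u y *\<^sub>R \<psi>' y) = (LINT y|lborel. v y *\<^sub>R \<psi>' y)"
    proof (rule integral_lebesgue_on_eq_lborel)
      show "u y *\<^sub>R \<psi>' y = v y *\<^sub>R \<psi>' y" for y
        using K sub by (cases "y \<in> K") (auto simp: v_def)
      show "v y *\<^sub>R \<psi>' y = 0" if "y \<notin> \<Omega>" for y using that pq(1) by (auto simp: v_def)
      show "(\<lambda>y. v y *\<^sub>R \<psi>' y) \<in> borel_measurable borel" using int[OF cont] by (simp add: borel_measurable_integrable)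
    qed (use \<Omega> in auto)
    then show ?thesis using \<open>(LINT y|lebesgue_on \<Omega>. u y *\<^sub>R \<psi>' y) = 0\<close> by simp
  qed
  then have "(LINT y|lborel. axis i 1 \<bullet> (v y *\<^sub>R \<psi>' y)) = 0"
    using int[OF cont] by (simp del: inner_scaleR_right)
  then have "(LINT y|lborel. v y * ?R y - v y * ?R (y - ?e)) = 0"
    by (simp add: inner_axis' \<psi>' right_diff_distrib)
  moreover have "(LINT y|lborel. v y * ?R (y - ?e)) = (LINT y|lborel. v (?e + y) * ?R y)"
    using integral_lborel_translate[of "\<lambda>y. v y * ?R (y - ?e)" ?e] int[OF R'] by (simp add: borel_measurable_integrable)
  moreover have "integrable lborel (\<lambda>y. v (?e + y) * ?R y)"
    using integrable_distr_eq[of "(+) ?e" lborel borel "\<lambda>y. v y * ?R (y - ?e)"] int[OF R']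
    by (simp add: lborel_distr_plus borel_measurable_integrable)
  ultimately have 0: "(LINT y|lborel. ?\<delta> x * (v y * ?R y - v (?e + y) * ?R y)) = 0"
    and int0: "integrable lborel (\<lambda>y. ?\<delta> x * (v y * ?R y - v (?e + y) * ?R y))"
    using int[OF R] int[OF R'] by (simp_all del: integral_mult_right_zero)
  have on_box: "?\<delta> x * (v y * ?R y - v (?e + y) * ?R y) > 0" if "y \<in> box a b" for y
  proof -
    have y: "y \<in> ?S" "?\<delta> x * ?\<delta> y > 0" using ab(1) that box_subset_cbox[of a b] by auto
    then have "y \<in> cbox p q" "?e + y \<in> cbox p q"
      using box_subset_cbox[of p q] by (auto simp: add.commute)
    then have eq: "?\<delta> x * (v y * ?R y - v (?e + y) * ?R y) = (?\<delta> x * ?\<delta> y) * ?R y"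
      by (simp add: v_def algebra_simps)
    show ?thesis unfolding eq by (intro mult_pos_pos y(2) bump_pos[OF _ that]) simp
  qed
  have "AE y in lborel. ?\<delta> x * (v y * ?R y - v (?e + y) * ?R y) = 0"
  proof (subst integral_nonneg_eq_0_iff_AE[OF int0, symmetric])
    show "AE y in lborel. 0 \<le> ?\<delta> x * (v y * ?R y - v (?e + y) * ?R y)"
    proof (rule AE_I2)
      fix y show "0 \<le> ?\<delta> x * (v y * ?R y - v (?e + y) * ?R y)"
        using on_box[of y] bump_eq_0[of 1 y a b] by (cases "y \<in> box a b") auto
    qed
  qed (rule 0)
  then have "AE y in lborel. y \<notin> box a b"
    by eventually_elim (use on_box in force)
  then have "box a b \<in> null_sets lborel" by (subst AE_iff_null_sets) auto
  then have "negligible (box a b)"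
    by (simp add: negligible_iff_null_sets null_sets_completionI)
  then show False using ab(2) open_not_negligible[of "box a b"] by auto
qed

text \<open>Inside a box any point is reached from any other by changing one coordinate at a time, so \<open>u\<close> is
locally constant.\<close>

lemma zero_weak_gradient_imp_constant:
  fixes u :: "real^'d \<Rightarrow> real"
  assumes u: "continuous_on \<Omega> u" and \<Omega>: "open \<Omega>" "connected \<Omega>"
    and zero: "has_weak_gradient u (\<lambda>x. 0) \<Omega>"
  shows "u constant_on \<Omega>"
proof (rule locally_constant_imp_constant[OF \<Omega>(2)])
  fix x assume "x \<in> \<Omega>"
  then obtain p q where pq: "cbox p q \<subseteq> \<Omega>" "x \<in> box p q" by (meson \<Omega>(1) open_contains_cbox)
  have step: "u (z + t *\<^sub>R axis i 1) = u z" if "z \<in> box p q" "z + t *\<^sub>R axis i 1 \<in> box p q" for z t i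
  proof -
    consider "t = 0" | "t > 0" | "t < 0" by linarith
    then show ?thesis
    proof cases
      case 2
      then show ?thesis using zero_weak_gradient_translation_invariant[OF u \<Omega>(1) zero pq(1)] that by blast
    next
      case 3
      then show ?thesis
        using zero_weak_gradient_translation_invariant[OF u \<Omega>(1) zero pq(1), of "z + t *\<^sub>R axis i 1" "- t" i] that by simp
    qed simp
  qed
  have "u y = u x" if y: "y \<in> box p q" for y
  proof -
    \<comment> \<open>The coordinates in \<open>J\<close> have already been moved from
      \<open>x\<close> to \<open>y\<close>.\<close>
    let ?z = "\<lambda>J. \<chi> i. if i \<in> J then y $ i else x $ i"
    have "u (?z J) = u x" if "finite J" for J
      using that
    proof induction
      case empty
      have "?z {} = x" by (simp add: vec_eq_iff)
      then show ?case by simp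
    next
      case (insert i J)
      have box: "?z I \<in> box p q" for I using y pq(2) by (auto simp: mem_box_cart)
      have e: "?z (insert i J) = ?z J + (y $ i - x $ i) *\<^sub>R axis i 1"
        using insert.hyps by (auto simp: vec_eq_iff axis_def)
      have "u (?z (insert i J)) = u (?z J)"
        unfolding e by (rule step[OF box]) (fold e, rule box)
      then show ?case using insert.IH by (rule trans)
    qed
    from this[of UNIV] show ?thesis by simp
  qed
  moreover have "openin (top_of_set \<Omega>) (box p q)"
    using pq(1) box_subset_cbox[of p q] by (intro open_subset) auto
  ultimately show "\<exists>T. openin (top_of_set \<Omega>) T \<and> x \<in> T \<and> (\<forall>y\<in>T. u y = u x)"
    using pq(2) by blast
qed

section \<open>Stiffness matrices\<close>

lemma square_integrable_imp_integrable:
  fixes f :: "real^'d \<Rightarrow> 'b::euclidean_space"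
  assumes "\<Omega> \<in> lmeasurable" "square_integrable \<Omega> f"
  shows "integrable (lebesgue_on \<Omega>) f"
proof (rule Bochner_Integration.integrable_bound)
  show "integrable (lebesgue_on \<Omega>) (\<lambda>x. 1 + (norm (f x))\<^sup>2)"
    using assms finite_measure.integrable_const[OF finite_measure_lebesgue_on]
    unfolding square_integrable_def by (intro Bochner_Integration.integrable_add) auto
  show "AE x in lebesgue_on \<Omega>. norm (f x) \<le> norm (1 + (norm (f x))\<^sup>2)"
  proof (rule AE_I2)
    fix x
    have "0 \<le> (norm (f x) - 1)\<^sup>2" "0 \<le> norm (f x)" by simp_all
    then have "norm (f x) \<le> 1 + (norm (f x))\<^sup>2" unfolding power2_diff power_one mult_1_right by linarith
    then show "norm (f x) \<le> norm (1 + (norm (f x))\<^sup>2)" by simp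
  qed
qed (use assms in \<open>simp add: square_integrable_def\<close>)

lemma integrable_scaleR_bounded:
  fixes f :: "'a \<Rightarrow> real" and g :: "'a \<Rightarrow> 'b::euclidean_space"
  assumes "integrable M f" "g \<in> borel_measurable M" "\<And>x. norm (g x) \<le> C"
  shows "integrable M (\<lambda>x. f x *\<^sub>R g x)"
proof (rule Bochner_Integration.integrable_bound)
  show "integrable M (\<lambda>x. C * f x)" using assms by simp
  show "AE x in M. norm (f x *\<^sub>R g x) \<le> norm (C * f x)"
  proof (rule AE_I2)
    fix x
    have "norm (f x *\<^sub>R g x) \<le> \<bar>f x\<bar> * \<bar>C\<bar>"
      using assms(3)[of x] by (auto intro!: mult_left_mono)
    then show "norm (f x *\<^sub>R g x) \<le> norm (C * f x)" by (simp add: abs_mult mult.commute)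
  qed
qed (use assms in \<open>auto intro: borel_measurable_scaleR\<close>)

lemma norm_matrix_vector_mult_le:
  fixes M :: "real^'n^'m"
  shows "norm (M *v x) \<le> norm M * norm x"
proof -
  have "norm (M *v x) \<le> L2_set (\<lambda>i. norm (M $ i) * norm x) UNIV"
    unfolding norm_vec_def[of "M *v x"]
    by (intro L2_set_mono) (simp_all add: matrix_vector_mul_component Cauchy_Schwarz_ineq2)
  then show ?thesis by (simp add: norm_vec_def[of M] L2_set_left_distrib)
qed

lemma borel_measurable_matrix_vector_mult:
  fixes M :: "'a \<Rightarrow> real^'n^'m"
  assumes "M \<in> borel_measurable N" "f \<in> borel_measurable N"
  shows "(\<lambda>x. M x *v f x) \<in> borel_measurable N"
  using assms
  by (rule borel_measurable_continuous_Pair)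
    (auto simp: matrix_vector_mult_def intro!: continuous_intros)

text \<open>The entries of a stiffness matrix involve the gradients chosen for the individual basis functions;
this turns their linear combinations into weak gradients of the represented functions.\<close>

lemma has_weak_gradient_sum:
  fixes u :: "'i \<Rightarrow> real^'d \<Rightarrow> real"
  assumes \<Omega>: "\<Omega> \<in> lmeasurable"
    and u: "\<And>k. k \<in> I \<Longrightarrow> square_integrable \<Omega> (u k)" and g: "\<And>k. k \<in> I \<Longrightarrow> square_integrable \<Omega> (g k)"
    and weak: "\<And>k. k \<in> I \<Longrightarrow> has_weak_gradient (u k) (g k) \<Omega>"
  shows "has_weak_gradient (\<lambda>x. \<Sum>k\<in>I. c k * u k x) (\<lambda>x. \<Sum>k\<in>I. c k *\<^sub>R g k x) \<Omega>"
  unfolding has_weak_gradient_def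
proof (intro allI impI)
  fix \<psi> :: "real^'d \<Rightarrow> real" and \<psi>'
  assume test: "test_function \<Omega> \<psi> \<and> (\<forall>x. GDERIV \<psi> x :> \<psi>' x)"
  then obtain C where cont: "continuous_on UNIV \<psi>" "continuous_on UNIV \<psi>'"
    and C: "\<And>x. \<bar>\<psi> x\<bar> \<le> C" "\<And>x. norm (\<psi>' x) \<le> C"
    using test_function_gradient[of \<Omega> \<psi> \<psi>'] by metis
  have "\<Omega> \<in> sets lebesgue" using \<Omega> by blast
  then have meas: "\<psi> \<in> borel_measurable (lebesgue_on \<Omega>)" "\<psi>' \<in> borel_measurable (lebesgue_on \<Omega>)"
    using cont by (auto intro!: continuous_imp_measurable_on_sets_lebesgue intro: continuous_on_subset)
  have 1: "integrable (lebesgue_on \<Omega>) (\<lambda>x. u k x *\<^sub>R \<psi>' x)" if "k \<in> I" for k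
    by (rule integrable_scaleR_bounded[OF square_integrable_imp_integrable[OF \<Omega> u[OF that]] meas(2) C(2)])
  have 2: "integrable (lebesgue_on \<Omega>) (\<lambda>x. \<psi> x *\<^sub>R g k x)" if k: "k \<in> I" for k
  proof (rule Bochner_Integration.integrable_bound)
    show "integrable (lebesgue_on \<Omega>) (\<lambda>x. C *\<^sub>R g k x)"
      using square_integrable_imp_integrable[OF \<Omega> g[OF k]] by simp
    show "(\<lambda>x. \<psi> x *\<^sub>R g k x) \<in> borel_measurable (lebesgue_on \<Omega>)"
      using meas g[OF k] by (auto simp: square_integrable_def intro: borel_measurable_scaleR)
    show "AE x in lebesgue_on \<Omega>. norm (\<psi> x *\<^sub>R g k x) \<le> norm (C *\<^sub>R g k x)"
    proof (rule AE_I2)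
      fix x show "norm (\<psi> x *\<^sub>R g k x) \<le> norm (C *\<^sub>R g k x)"
        using C(1)[of x] by (auto intro!: mult_right_mono)
    qed
  qed
  have "(LINT x|lebesgue_on \<Omega>. (\<Sum>k\<in>I. c k * u k x) *\<^sub>R \<psi>' x)
      = (\<Sum>k\<in>I. c k *\<^sub>R (LINT x|lebesgue_on \<Omega>. u k x *\<^sub>R \<psi>' x))"
    using 1 by (simp add: scaleR_sum_left flip: scaleR_scaleR)
  also have "\<dots> = (\<Sum>k\<in>I. - (c k *\<^sub>R (LINT x|lebesgue_on \<Omega>. \<psi> x *\<^sub>R g k x)))"
    using weak test unfolding has_weak_gradient_def by (intro sum.cong) auto
  also have "\<dots> = - (LINT x|lebesgue_on \<Omega>. (\<Sum>k\<in>I. c k *\<^sub>R (\<psi> x *\<^sub>R g k x)))"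
    using 2 by (simp add: sum_negf del: scaleR_scaleR)
  finally show "(LINT x|lebesgue_on \<Omega>. (\<Sum>k\<in>I. c k * u k x) *\<^sub>R \<psi>' x)
      = - (LINT x|lebesgue_on \<Omega>. \<psi> x *\<^sub>R (\<Sum>k\<in>I. c k *\<^sub>R g k x))"
    by (simp add: scaleR_sum_right mult.commute)
qed

text \<open>Test functions supported in \<open>U\<close> see a constant multiple of their own gradient, which has integral
zero. This yields both the locality of weak gradients, used on elements outside the patches, and
the vanishing of the gradients of constants.\<close>

lemma weak_gradient_eq_0_where_constant:
  fixes g :: "real^'d \<Rightarrow> real^'d"
  assumes \<Omega>: "\<Omega> \<in> sets lebesgue" and g: "integrable (lebesgue_on \<Omega>) g" "has_weak_gradient u g \<Omega>"
    and U: "open U" "U \<subseteq> \<Omega>" and q: "\<And>x. x \<in> U \<Longrightarrow> u x = q"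
  shows "AE x in lebesgue_on \<Omega>. x \<in> U \<longrightarrow> g x = 0"
proof (rule AE_eq_0_if_orthogonal_to_bumps[OF g(1) \<Omega> U])
  fix m :: real and a b :: "real^'d" assume m: "0 < m" and ab: "cbox a b \<subseteq> U"
  let ?F = "\<lambda>i. bump_jet m (a $ i) (b $ i)"
  define \<psi>' :: "real^'d \<Rightarrow> real^'d" where "\<psi>' x = (\<chi> i. tensor ?F [i] x)" for x
  have D: "GDERIV (bump m a b) x :> \<psi>' x" for x
    unfolding bump_def \<psi>'_def by (rule GDERIV_tensor[OF smooth_bump_jet])
  have test: "test_function (cbox a b) (bump m a b)" "test_function \<Omega> (bump m a b)"
    using m ab U by (auto intro!: test_function_bump)
  obtain K where K: "K \<subseteq> cbox a b" "\<And>x. x \<notin> K \<Longrightarrow> \<psi>' x = 0"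
    using test_function_gradient[OF test(1) D] by metis
  have "(\<lambda>x. u x *\<^sub>R \<psi>' x) = (\<lambda>x. q *\<^sub>R \<psi>' x)"
  proof
    fix x show "u x *\<^sub>R \<psi>' x = q *\<^sub>R \<psi>' x"
      using K ab q[of x] by (cases "x \<in> K") auto
  qed
  then have "(LINT x|lebesgue_on \<Omega>. u x *\<^sub>R \<psi>' x) = 0"
    using integral_test_gradient_eq_0[OF \<Omega> test(2) D] by simp
  then show "(LINT x|lebesgue_on \<Omega>. bump m a b x *\<^sub>R g x) = 0"
    using g(2) test(2) D unfolding has_weak_gradient_def by fastforce
qed

locale conforming_basis =
  fixes \<Omega> :: "(real^'d) set" and \<phi> :: "'n::finite \<Rightarrow> real^'d \<Rightarrow> real"
  assumes open_domain: "open \<Omega>" and bounded_domain: "bounded \<Omega>" and connected_domain: "connected \<Omega>"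
    and nonempty_domain: "\<Omega> \<noteq> {}"
    and conforming: "\<phi> k \<in> continuous_H1 \<Omega>"
begin

abbreviation grad :: "'n \<Rightarrow> real^'d \<Rightarrow> real^'d" where
  "grad k \<equiv> weak_gradient \<Omega> (\<phi> k)"

definition combination :: "real^'n \<Rightarrow> real^'d \<Rightarrow> real" where
  "combination c x = (\<Sum>k\<in>UNIV. c $ k * \<phi> k x)"

definition combined_grad :: "real^'n \<Rightarrow> real^'d \<Rightarrow> real^'d" where
  "combined_grad c x = (\<Sum>k\<in>UNIV. c $ k *\<^sub>R grad k x)"

lemma lmeasurable_domain: "\<Omega> \<in> lmeasurable"
  using open_domain bounded_domain by (rule lmeasurable_open[rotated])

lemma sets_domain: "\<Omega> \<in> sets lebesgue"
  using lmeasurable_domain by blast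

lemma grad: "square_integrable \<Omega> (grad k)" "has_weak_gradient (\<phi> k) (grad k) \<Omega>"
proof -
  have "\<exists>g. square_integrable \<Omega> g \<and> has_weak_gradient (\<phi> k) g \<Omega>"
    using conforming[of k] by (simp add: continuous_H1_def H1_def)
  then have "square_integrable \<Omega> (grad k) \<and> has_weak_gradient (\<phi> k) (grad k) \<Omega>"
    unfolding weak_gradient_def by (rule someI_ex)
  then show "square_integrable \<Omega> (grad k)" "has_weak_gradient (\<phi> k) (grad k) \<Omega>" by auto
qed

lemma basis_props:
  "square_integrable \<Omega> (\<phi> k)" "continuous_on \<Omega> (\<phi> k)"
  using conforming[of k] closure_subset
  by (auto simp: continuous_H1_def H1_def intro: continuous_on_subset)

lemma integrable_combined_grad: "integrable (lebesgue_on \<Omega>) (combined_grad c)"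
  unfolding combined_grad_def
  by (intro Bochner_Integration.integrable_sum integrable_scaleR_right
      square_integrable_imp_integrable[OF lmeasurable_domain grad(1)])

lemma weak_combined_grad: "has_weak_gradient (combination c) (combined_grad c) \<Omega>"
  unfolding combined_grad_def[abs_def] combination_def[abs_def]
  by (intro has_weak_gradient_sum lmeasurable_domain basis_props grad)

lemma continuous_combination: "continuous_on \<Omega> (combination c)"
  unfolding combination_def by (intro continuous_intros basis_props)

lemma combined_grad_eq_0_where_constant:
  assumes "open U" "U \<subseteq> \<Omega>" "\<And>x. x \<in> U \<Longrightarrow> combination c x = q"
  shows "AE x in lebesgue_on \<Omega>. x \<in> U \<longrightarrow> combined_grad c x = 0"
  using weak_gradient_eq_0_where_constant[OF sets_domain integrable_combined_grad weak_combined_grad assms] .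

text \<open>Identifies the common null space of all stiffness matrices: the energy of a coefficient vector
vanishes exactly when its gradient does, for any diffusion coefficient.\<close>

lemma combined_grad_eq_0_iff_constant:
  "(AE x in lebesgue_on \<Omega>. combined_grad c x = 0) \<longleftrightarrow> combination c constant_on \<Omega>"
proof
  assume 0: "AE x in lebesgue_on \<Omega>. combined_grad c x = 0"
  have "has_weak_gradient (combination c) (\<lambda>x. 0) \<Omega>"
    unfolding has_weak_gradient_def
  proof (intro allI impI)
    fix \<psi> :: "real^'d \<Rightarrow> real" and \<psi>'
    assume "test_function \<Omega> \<psi> \<and> (\<forall>x. GDERIV \<psi> x :> \<psi>' x)"
    then have "(LINT x|lebesgue_on \<Omega>. combination c x *\<^sub>R \<psi>' x)
        = - (LINT x|lebesgue_on \<Omega>. \<psi> x *\<^sub>R combined_grad c x)"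
      using weak_combined_grad[of c] unfolding has_weak_gradient_def by blast
    also have "(LINT x|lebesgue_on \<Omega>. \<psi> x *\<^sub>R combined_grad c x) = 0"
      using 0 by (intro integral_eq_zero_AE) auto
    finally show "(LINT x|lebesgue_on \<Omega>. combination c x *\<^sub>R \<psi>' x)
        = - (LINT x|lebesgue_on \<Omega>. \<psi> x *\<^sub>R 0)" by simp
  qed
  then show "combination c constant_on \<Omega>"
    by (rule zero_weak_gradient_imp_constant[OF continuous_combination open_domain connected_domain])
next
  assume "combination c constant_on \<Omega>"
  then obtain q where q: "\<And>x. x \<in> \<Omega> \<Longrightarrow> combination c x = q" by (auto simp: constant_on_def)
  have "AE x in lebesgue_on \<Omega>. x \<in> \<Omega> \<longrightarrow> combined_grad c x = 0"
    by (rule combined_grad_eq_0_where_constant[OF open_domain subset_refl q])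
  moreover have "AE x in lebesgue_on \<Omega>. x \<in> \<Omega>" by (rule AE_I2) simp
  ultimately show "AE x in lebesgue_on \<Omega>. combined_grad c x = 0" by eventually_elim simp
qed

lemma integrable_energy:
  assumes A: "diffusion_coefficient \<Omega> A"
  shows "integrable (lebesgue_on \<Omega>) (\<lambda>x. grad l x \<bullet> (A x *v grad k x))"
proof -
  obtain C where C: "AE x in lebesgue_on \<Omega>. norm (A x) \<le> C"
    and meas: "A \<in> borel_measurable (lebesgue_on \<Omega>)"
    using A by (auto simp: diffusion_coefficient_def)
  show ?thesis
  proof (rule Bochner_Integration.integrable_bound)
    show "integrable (lebesgue_on \<Omega>) (\<lambda>x. C * ((norm (grad l x))\<^sup>2 + (norm (grad k x))\<^sup>2))"
      using grad(1) by (auto simp: square_integrable_def)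
    show "(\<lambda>x. grad l x \<bullet> (A x *v grad k x)) \<in> borel_measurable (lebesgue_on \<Omega>)"
      using grad(1) meas
      by (intro borel_measurable_inner borel_measurable_matrix_vector_mult) (auto simp: square_integrable_def)
    show "AE x in lebesgue_on \<Omega>. norm (grad l x \<bullet> (A x *v grad k x))
        \<le> norm (C * ((norm (grad l x))\<^sup>2 + (norm (grad k x))\<^sup>2))"
      using C
    proof eventually_elim
      case (elim x)
      let ?l = "norm (grad l x)" and ?k = "norm (grad k x)"
      have "norm (grad l x \<bullet> (A x *v grad k x)) \<le> ?l * norm (A x *v grad k x)"
        by (simp add: Cauchy_Schwarz_ineq2)
      also have "\<dots> \<le> ?l * (C * ?k)"
        by (meson elim mult_left_mono mult_right_mono norm_ge_zero norm_matrix_vector_mult_le order_trans)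
      also have "\<dots> = C * (?l * ?k)" by simp
      also have "\<dots> \<le> C * (?l\<^sup>2 + ?k\<^sup>2)"
      proof (rule mult_left_mono)
        have "0 \<le> (?l - ?k)\<^sup>2" "0 \<le> ?l * ?k" by simp_all
        then show "?l * ?k \<le> ?l\<^sup>2 + ?k\<^sup>2" unfolding power2_diff power_one mult_1_right by linarith
        show "0 \<le> C" using elim norm_ge_zero order_trans by blast
      qed
      finally show ?case by simp
    qed
  qed
qed

lemma energy_expand:
  "combined_grad d x \<bullet> (M *v combined_grad c x)
    = (\<Sum>k\<in>UNIV. c $ k * (\<Sum>l\<in>UNIV. d $ l * (grad l x \<bullet> (M *v grad k x))))"
proof -
  have "M *v combined_grad c x = (\<Sum>k\<in>UNIV. c $ k *\<^sub>R (M *v grad k x))"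
    unfolding combined_grad_def
    by (simp add: linear_sum[OF matrix_vector_mul_linear] matrix_vector_mult_scaleR)
  then show ?thesis
    by (simp add: inner_sum_right combined_grad_def inner_sum_left)
qed

lemma integrable_combined_energy:
  assumes "diffusion_coefficient \<Omega> A"
  shows "integrable (lebesgue_on \<Omega>) (\<lambda>x. combined_grad d x \<bullet> (A x *v combined_grad c x))"
  unfolding energy_expand
  by (intro Bochner_Integration.integrable_sum integrable_mult_right integrable_energy[OF assms])

lemma stiffness_form:
  assumes A: "diffusion_coefficient \<Omega> A"
  shows "c \<bullet> (stiffness \<Omega> A \<phi> *v d) = (LINT x|lebesgue_on \<Omega>. combined_grad d x \<bullet> (A x *v combined_grad c x))"
proof -
  have "c \<bullet> (stiffness \<Omega> A \<phi> *v d) = (\<Sum>k\<in>UNIV. c $ k * (\<Sum>l\<in>UNIV. d $ l * stiffness \<Omega> A \<phi> $ k $ l))"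
    by (simp add: inner_vec_def matrix_vector_mult_def mult.commute)
  also have "\<dots> = (\<Sum>k\<in>UNIV. c $ k * (\<Sum>l\<in>UNIV. d $ l *
      (LINT x|lebesgue_on \<Omega>. grad l x \<bullet> (A x *v grad k x))))"
    by (simp add: stiffness_def)
  also have "\<dots> = (LINT x|lebesgue_on \<Omega>. combined_grad d x \<bullet> (A x *v combined_grad c x))"
    unfolding energy_expand using integrable_energy[OF A] by simp
  finally show ?thesis .
qed

lemma stiffness_symmetric:
  assumes A: "diffusion_coefficient \<Omega> A"
  shows "transpose (stiffness \<Omega> A \<phi>) = stiffness \<Omega> A \<phi>"
proof -
  have sym: "AE x in lebesgue_on \<Omega>. transpose (A x) = A x"
    using A by (simp add: diffusion_coefficient_def)
  have "stiffness \<Omega> A \<phi> $ l $ k = stiffness \<Omega> A \<phi> $ k $ l" for k l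
  proof -
    have "AE x in lebesgue_on \<Omega>. grad k x \<bullet> (A x *v grad l x) = grad l x \<bullet> (A x *v grad k x)"
      using sym by eventually_elim (rule inner_matrix_symmetric)
    then show ?thesis
      unfolding stiffness_def using integrable_energy[OF A]
      by (auto intro!: integral_cong_AE borel_measurable_integrable)
  qed
  then show ?thesis by (simp add: vec_eq_iff transpose_def)
qed

lemma stiffness_form_eq_0_iff:
  assumes A: "diffusion_coefficient \<Omega> A"
  shows "c \<bullet> (stiffness \<Omega> A \<phi> *v c) = 0 \<longleftrightarrow> (AE x in lebesgue_on \<Omega>. combined_grad c x = 0)"
    and "0 \<le> c \<bullet> (stiffness \<Omega> A \<phi> *v c)"
proof -
  let ?q = "\<lambda>x. combined_grad c x \<bullet> (A x *v combined_grad c x)"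
  obtain a where a: "a > 0" "AE x in lebesgue_on \<Omega>. \<forall>\<xi>. a * (norm \<xi>)\<^sup>2 \<le> \<xi> \<bullet> (A x *v \<xi>)"
    using A by (auto simp: diffusion_coefficient_def)
  have nonneg: "AE x in lebesgue_on \<Omega>. 0 \<le> ?q x"
    using a(2)
  proof eventually_elim
    case (elim x)
    have "0 \<le> a * (norm (combined_grad c x))\<^sup>2" using a(1) by simp
    then show ?case using elim order_trans by blast
  qed
  show "0 \<le> c \<bullet> (stiffness \<Omega> A \<phi> *v c)"
    unfolding stiffness_form[OF A] using nonneg by (rule integral_nonneg_AE)
  have "(LINT x|lebesgue_on \<Omega>. ?q x) = 0 \<longleftrightarrow> (AE x in lebesgue_on \<Omega>. ?q x = 0)"
    by (rule integral_nonneg_eq_0_iff_AE[OF integrable_combined_energy[OF A] nonneg])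
  also have "\<dots> \<longleftrightarrow> (AE x in lebesgue_on \<Omega>. combined_grad c x = 0)"
  proof
    assume "AE x in lebesgue_on \<Omega>. ?q x = 0"
    then show "AE x in lebesgue_on \<Omega>. combined_grad c x = 0"
      using a(2)
    proof eventually_elim
      case (elim x)
      then have "a * (norm (combined_grad c x))\<^sup>2 \<le> 0" by metis
      then show ?case using a(1) by (simp add: mult_le_0_iff)
    qed
  qed (auto elim: eventually_mono)
  finally show "c \<bullet> (stiffness \<Omega> A \<phi> *v c) = 0 \<longleftrightarrow> (AE x in lebesgue_on \<Omega>. combined_grad c x = 0)"
    unfolding stiffness_form[OF A] .
qed

lemma null_space_stiffness:
  assumes A: "diffusion_coefficient \<Omega> A"
  shows "null_space (stiffness \<Omega> A \<phi>) = {c. combination c constant_on \<Omega>}"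
proof (intro equalityI subsetI)
  fix c assume "c \<in> null_space (stiffness \<Omega> A \<phi>)"
  then show "c \<in> {c. combination c constant_on \<Omega>}"
    using stiffness_form_eq_0_iff(1)[OF A, of c] combined_grad_eq_0_iff_constant[of c]
    by (simp add: null_space_def)
next
  fix c assume "c \<in> {c. combination c constant_on \<Omega>}"
  then have 0: "AE x in lebesgue_on \<Omega>. combined_grad c x = 0"
    using combined_grad_eq_0_iff_constant by simp
  have "d \<bullet> (stiffness \<Omega> A \<phi> *v c) = 0" for d
    unfolding stiffness_form[OF A] using 0 by (intro integral_eq_zero_AE) auto
  from this[of "stiffness \<Omega> A \<phi> *v c"] show "c \<in> null_space (stiffness \<Omega> A \<phi>)"
    by (simp add: null_space_def)
qed

text \<open>By linear independence a combination is determined by its coefficients, so those representing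
constants are the multiples of the ones representing 1.\<close>

lemma dim_constant_combinations:
  assumes indep: "lin_indep_on \<Omega> \<phi>" and const: "span_contains_constants_on \<Omega> \<phi>"
  shows "dim {c. combination c constant_on \<Omega>} = 1"
proof -
  obtain c1 where "\<And>x. x \<in> \<Omega> \<Longrightarrow> (\<Sum>k\<in>UNIV. c1 k * \<phi> k x) = 1"
    using const unfolding span_contains_constants_on_def by blast
  then have one: "combination (\<chi> k. c1 k) x = 1" if "x \<in> \<Omega>" for x
    using that by (simp add: combination_def)
  let ?e = "\<chi> k. c1 k"
  obtain x0 where "x0 \<in> \<Omega>" using nonempty_domain by blast
  have "?e \<noteq> 0"
  proof
    assume "?e = 0"
    then have "combination 0 x0 = 1" using one[OF \<open>x0 \<in> \<Omega>\<close>] by metis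
    then show False by (simp add: combination_def)
  qed
  have "c \<in> span {?e}" if c: "combination c constant_on \<Omega>" for c
  proof -
    obtain q where q: "\<And>x. x \<in> \<Omega> \<Longrightarrow> combination c x = q" using c by (auto simp: constant_on_def)
    have "(\<Sum>k\<in>UNIV. (c $ k - q * c1 k) * \<phi> k x) = 0" if "x \<in> \<Omega>" for x
      using q[OF that] one[OF that]
      by (simp add: combination_def left_diff_distrib sum_subtractf mult.assoc flip: sum_distrib_left)
    then have "c $ k - q * c1 k = 0" for k
      using indep unfolding lin_indep_on_def by (elim allE[of _ "\<lambda>k. c $ k - q * c1 k"]) blast
    then have "c = q *\<^sub>R ?e" by (simp add: vec_eq_iff)
    then show ?thesis by (metis span_base span_scale singletonI)
  qed
  moreover have "?e \<in> {c. combination c constant_on \<Omega>}" using one by (auto simp: constant_on_def)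
  ultimately have "span {c. combination c constant_on \<Omega>} = span {?e}"
    by (intro equalityI span_minimal) (auto intro: span_base)
  then have "dim {c. combination c constant_on \<Omega>} = dim {?e}" by (metis dim_span)
  also have "\<dots> = 1" using \<open>?e \<noteq> 0\<close> by (simp add: dim_singleton)
  finally show ?thesis .
qed

end

section \<open>Elements and patches\<close>

text \<open>The domain is the interior of its closure, so the interiors of the elements lie in the domain
itself and not merely in its closure.\<close>

locale element_decomposition =
  fixes \<Omega> :: "(real^'d) set" and Ne :: nat and E :: "nat \<Rightarrow> (real^'d) set"
  assumes decomposition: "is_decomposition \<Omega> Ne E" and regular_open: "interior (closure \<Omega>) = \<Omega>"
begin

lemma closure_interior_element: "j \<in> {1..Ne} \<Longrightarrow> closure (interior (E j)) = E j"
  using decomposition unfolding is_decomposition_def by blast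

lemma closed_element: "j \<in> {1..Ne} \<Longrightarrow> closed (E j)"
  by (metis closed_closure closure_interior_element)

lemma union_elements: "(\<Union>j\<in>{1..Ne}. E j) = closure \<Omega>"
  using decomposition unfolding is_decomposition_def by blast

lemma disjoint_interiors:
  "i \<in> {1..Ne} \<Longrightarrow> j \<in> {1..Ne} \<Longrightarrow> i \<noteq> j \<Longrightarrow> interior (E i) \<inter> interior (E j) = {}"
  using decomposition unfolding is_decomposition_def by blast

lemma interior_element_subset: "j \<in> {1..Ne} \<Longrightarrow> interior (E j) \<subseteq> \<Omega>"
  using interior_mono[of "E j" "closure \<Omega>"] union_elements regular_open by blast

lemma AE_interior_element: "AE x in lebesgue_on \<Omega>. \<exists>j\<in>{1..Ne}. x \<in> interior (E j)"
proof -
  have "negligible (\<Union>j\<in>{1..Ne}. frontier (E j))"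
    using decomposition unfolding is_decomposition_def by (intro negligible_Union) auto
  then have "AE x in lebesgue. x \<notin> (\<Union>j\<in>{1..Ne}. frontier (E j))"
    by (intro AE_not_in) (simp add: negligible_iff_null_sets)
  moreover have "x \<in> \<Omega> \<longrightarrow> (\<exists>j\<in>{1..Ne}. x \<in> interior (E j))" if "x \<notin> (\<Union>j\<in>{1..Ne}. frontier (E j))" for x
  proof
    assume "x \<in> \<Omega>"
    then obtain j where "j \<in> {1..Ne}" "x \<in> E j" using union_elements closure_subset by blast
    moreover from this have "x \<notin> frontier (E j)" using that by blast
    ultimately have "x \<in> interior (E j)"
      using closed_element[of j] by (simp add: frontier_def)
    then show "\<exists>j\<in>{1..Ne}. x \<in> interior (E j)" using \<open>j \<in> {1..Ne}\<close> by blast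
  qed
  ultimately have "AE x in lebesgue. x \<in> \<Omega> \<longrightarrow> (\<exists>j\<in>{1..Ne}. x \<in> interior (E j))"
    by (auto elim: eventually_mono)
  moreover have "open \<Omega>" by (metis open_interior regular_open)
  ultimately show ?thesis by (simp add: AE_restrict_space_iff)
qed

text \<open>The elements whose interior meets the open set where \<open>f\<close> is nonzero cover that set, because every
element is the closure of its interior. Each of them belongs to any covering family, because the
interiors are disjoint. So their union is the patch.\<close>

lemma element_subset_patch:
  assumes f: "continuous_on \<Omega> f" and j: "j \<in> {1..Ne}" "x \<in> interior (E j)" "f x \<noteq> 0"
  shows "E j \<subseteq> patch \<Omega> Ne E f"
proof -
  define S where "S = {x \<in> \<Omega>. f x \<noteq> 0}"
  define J where "J = {j \<in> {1..Ne}. interior (E j) \<inter> S \<noteq> {}}"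
  have "open \<Omega>" by (metis open_interior regular_open)
  moreover have "S = \<Omega> \<inter> f -` (- {0})" by (auto simp: S_def)
  ultimately have S: "open S" using continuous_open_preimage[OF f, of "- {0}"] by auto
  have J: "J \<subseteq> {1..Ne}" "finite J" by (auto simp: J_def)
  have meets: "U \<inter> interior (E i) \<noteq> {}" if "open U" "y \<in> U" "y \<in> E i" "i \<in> {1..Ne}" for U y i
    using open_Int_closure_eq_empty[OF that(1), of "interior (E i)"] that closure_interior_element by blast
  have least: "J \<subseteq> I" if I: "I \<subseteq> {1..Ne}" "S \<subseteq> (\<Union>i\<in>I. E i)" for I
  proof
    fix i assume "i \<in> J"
    then obtain y where i: "i \<in> {1..Ne}" "y \<in> interior (E i)" "y \<in> S" by (auto simp: J_def)
    then obtain l where l: "l \<in> I" "y \<in> E l" using I by blast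
    have "interior (E i) \<inter> interior (E l) \<noteq> {}"
      using i l I meets[of "interior (E i)" y l] by blast
    then show "i \<in> I" using disjoint_interiors[of i l] i l I by blast
  qed
  have "closed (\<Union>i\<in>J. E i)" using J closed_element by (intro closed_UN) auto
  have "S \<subseteq> (\<Union>i\<in>J. E i)"
  proof (rule ccontr)
    assume "\<not> S \<subseteq> (\<Union>i\<in>J. E i)"
    then obtain y where y: "y \<in> S - (\<Union>i\<in>J. E i)" by blast
    then have "y \<in> \<Omega>" by (simp add: S_def)
    then obtain i where i: "i \<in> {1..Ne}" "y \<in> E i" using union_elements closure_subset by blast
    have "(S - (\<Union>i\<in>J. E i)) \<inter> interior (E i) \<noteq> {}"
      using meets[OF open_Diff[OF S \<open>closed (\<Union>i\<in>J. E i)\<close>] y] i by blast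
    then have "i \<in> J" using i by (auto simp: J_def)
    then show False using y i by blast
  qed
  then have cover: "support_in \<Omega> f \<subseteq> (\<Union>i\<in>J. E i)"
    unfolding support_in_def S_def[symmetric] using \<open>closed (\<Union>i\<in>J. E i)\<close> by (rule closure_minimal)
  have minimal: "(\<Union>i\<in>J. E i) \<subseteq> (\<Union>i\<in>I. E i)" if "I \<subseteq> {1..Ne}" "support_in \<Omega> f \<subseteq> (\<Union>i\<in>I. E i)" for I
  proof -
    have "S \<subseteq> support_in \<Omega> f" unfolding support_in_def S_def by (rule closure_subset)
    then show ?thesis using least[OF that(1)] that(2) by blast
  qed
  have "patch \<Omega> Ne E f = (\<Union>i\<in>J. E i)"
    unfolding patch_def
  proof (rule the_equality)
    show "(\<exists>Ja\<subseteq>{1..Ne}. (\<Union>i\<in>J. E i) = (\<Union>i\<in>Ja. E i)) \<and> support_in \<Omega> f \<subseteq> (\<Union>i\<in>J. E i) \<and>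
        (\<forall>Ja\<subseteq>{1..Ne}. support_in \<Omega> f \<subseteq> (\<Union>i\<in>Ja. E i) \<longrightarrow> (\<Union>i\<in>J. E i) \<subseteq> (\<Union>i\<in>Ja. E i))"
      using J cover minimal by blast
  next
    fix P assume P: "(\<exists>J\<subseteq>{1..Ne}. P = (\<Union>i\<in>J. E i)) \<and> support_in \<Omega> f \<subseteq> P \<and>
        (\<forall>J\<subseteq>{1..Ne}. support_in \<Omega> f \<subseteq> (\<Union>i\<in>J. E i) \<longrightarrow> P \<subseteq> (\<Union>i\<in>J. E i))"
    then obtain I where I: "I \<subseteq> {1..Ne}" "P = (\<Union>i\<in>I. E i)" by blast
    have "P \<subseteq> (\<Union>i\<in>J. E i)" using P J(1) cover by blast
    moreover have "(\<Union>i\<in>J. E i) \<subseteq> P"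
    proof -
      have "support_in \<Omega> f \<subseteq> P" using P by (elim conjE)
      then show ?thesis unfolding I(2) by (rule minimal[OF I(1)])
    qed
    ultimately show "P = (\<Union>i\<in>J. E i)" by blast
  qed
  moreover have "j \<in> J" using j interior_element_subset[of j] by (auto simp: J_def S_def)
  ultimately show ?thesis by blast
qed

lemma alpha_max_le_lambda_U:
  "j \<in> {1..Ne} \<Longrightarrow> E j \<subseteq> patch \<Omega> Ne E f \<Longrightarrow> alpha_max At A (E j) \<le> lambda_U \<Omega> Ne E At A f"
  unfolding lambda_U_def by (rule Max_ge) auto

lemma lambda_L_le_alpha_min:
  "j \<in> {1..Ne} \<Longrightarrow> E j \<subseteq> patch \<Omega> Ne E f \<Longrightarrow> lambda_L \<Omega> Ne E At A f \<le> alpha_min At A (E j)"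
  unfolding lambda_L_def by (rule Min_le) auto

end

lemma AE_eig_max_le_alpha_max:
  "AE x in lebesgue_on S. ereal (eig_max (matrix_inv (At x) ** A x)) \<le> alpha_max At A S"
  unfolding alpha_max_def by (rule esssup_AE)

lemma AE_alpha_min_le_eig_min:
  "AE x in lebesgue_on S. alpha_min At A S \<le> ereal (eig_min (matrix_inv (At x) ** A x))"
  using esssup_AE[of "\<lambda>x. - ereal (eig_min (matrix_inv (At x) ** A x))" "lebesgue_on S"]
  unfolding alpha_min_def essinf_def
  by eventually_elim (simp add: ereal_uminus_le_reorder)

section \<open>Comparison of the stiffness matrices\<close>

locale finite_element_setting = conforming_basis \<Omega> \<phi> + element_decomposition \<Omega> Ne E
  for \<Omega> :: "(real^'d) set" and \<phi> :: "'n::finite \<Rightarrow> real^'d \<Rightarrow> real"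
    and Ne :: nat and E :: "nat \<Rightarrow> (real^'d) set" +
  fixes A At :: "real^'d \<Rightarrow> real^'d^'d"
  assumes A: "diffusion_coefficient \<Omega> A" and At: "diffusion_coefficient \<Omega> At"
begin

text \<open>On an element that lies in none of the patches of the basis functions present in the combination,
the combination vanishes identically and so does its gradient. Hence a property needs to be
known only on the elements of these patches. With \<open>P\<close> a bound on the eigenvalues of the
coefficient matrices, this is the step from local to global quantities.\<close>

lemma AE_combined_grad_eq_0_or:
  assumes P: "\<And>k j. c $ k \<noteq> 0 \<Longrightarrow> j \<in> {1..Ne} \<Longrightarrow> E j \<subseteq> patch \<Omega> Ne E (\<phi> k) \<Longrightarrow>
      AE x in lebesgue_on (E j). P x"
  shows "AE x in lebesgue_on \<Omega>. combined_grad c x = 0 \<or> P x"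
proof -
  have "AE x in lebesgue_on \<Omega>. x \<in> interior (E j) \<longrightarrow> combined_grad c x = 0 \<or> P x" if j: "j \<in> {1..Ne}" for j
  proof (cases "\<exists>k. c $ k \<noteq> 0 \<and> E j \<subseteq> patch \<Omega> Ne E (\<phi> k)")
    case True
    then have "AE x in lebesgue_on (E j). P x" using P j by blast
    then have "AE x in lebesgue. x \<in> E j \<longrightarrow> P x"
      using closed_element[OF j] by (simp add: AE_restrict_space_iff)
    then have "AE x in lebesgue. x \<in> \<Omega> \<longrightarrow> x \<in> interior (E j) \<longrightarrow> combined_grad c x = 0 \<or> P x"
      by eventually_elim (use interior_subset in blast)
    then show ?thesis using sets_domain by (simp add: AE_restrict_space_iff)
  next
    case False
    have zero: "combination c x = 0" if "x \<in> interior (E j)" for x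
      unfolding combination_def using False element_subset_patch[OF basis_props(2) j that]
      by (intro sum.neutral) auto
    have "AE x in lebesgue_on \<Omega>. x \<in> interior (E j) \<longrightarrow> combined_grad c x = 0"
      by (rule combined_grad_eq_0_where_constant[OF open_interior interior_element_subset[OF j] zero])
    then show ?thesis by eventually_elim simp
  qed
  then have "AE x in lebesgue_on \<Omega>. \<forall>j\<in>{1..Ne}. x \<in> interior (E j) \<longrightarrow> combined_grad c x = 0 \<or> P x"
    by (intro AE_finite_allI) auto
  then show ?thesis using AE_interior_element by eventually_elim blast
qed

lemma AE_pointwise_spectral_bounds:
  "AE x in lebesgue_on \<Omega>. \<forall>\<xi>.
     eig_min (matrix_inv (At x) ** A x) * (\<xi> \<bullet> (At x *v \<xi>)) \<le> \<xi> \<bullet> (A x *v \<xi>) \<and>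
     \<xi> \<bullet> (A x *v \<xi>) \<le> eig_max (matrix_inv (At x) ** A x) * (\<xi> \<bullet> (At x *v \<xi>)) \<and>
     0 \<le> \<xi> \<bullet> (At x *v \<xi>)"
proof -
  obtain a where a: "a > 0" "AE x in lebesgue_on \<Omega>. \<forall>\<xi>. a * (norm \<xi>)\<^sup>2 \<le> \<xi> \<bullet> (At x *v \<xi>)"
    using At by (auto simp: diffusion_coefficient_def)
  have "AE x in lebesgue_on \<Omega>. transpose (A x) = A x" "AE x in lebesgue_on \<Omega>. transpose (At x) = At x"
    using A At by (auto simp: diffusion_coefficient_def)
  then show ?thesis using a(2)
  proof eventually_elim
    case (elim x)
    have pos: "0 < \<xi> \<bullet> (At x *v \<xi>)" if "\<xi> \<noteq> 0" for \<xi>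
    proof -
      have "0 < a * (norm \<xi>)\<^sup>2" using a(1) that by simp
      then show ?thesis using elim(3) less_le_trans by blast
    qed
    have "0 \<le> \<xi> \<bullet> (At x *v \<xi>)" for \<xi>
      using pos[of \<xi>] by (cases "\<xi> = 0") auto
    then show ?case using eigenvalues_bound_form[OF elim(1,2) pos] by blast
  qed
qed

lemma stiffness_form_le:
  assumes "\<And>k. c $ k \<noteq> 0 \<Longrightarrow> lambda_U \<Omega> Ne E At A (\<phi> k) \<le> ereal t"
  shows "c \<bullet> (stiffness \<Omega> A \<phi> *v c) \<le> t * (c \<bullet> (stiffness \<Omega> At \<phi> *v c))"
proof -
  have "AE x in lebesgue_on \<Omega>. combined_grad c x = 0 \<or> eig_max (matrix_inv (At x) ** A x) \<le> t"
  proof (rule AE_combined_grad_eq_0_or)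
    fix k j assume "c $ k \<noteq> 0" and j: "j \<in> {1..Ne}" "E j \<subseteq> patch \<Omega> Ne E (\<phi> k)"
    then have le: "alpha_max At A (E j) \<le> ereal t"
      using assms alpha_max_le_lambda_U order_trans by blast
    from AE_eig_max_le_alpha_max[where S = "E j" and At = At and A = A]
    show "AE x in lebesgue_on (E j). eig_max (matrix_inv (At x) ** A x) \<le> t"
      by (rule eventually_mono) (metis le ereal_less_eq(3) order_trans)
  qed
  with AE_pointwise_spectral_bounds
  have "AE x in lebesgue_on \<Omega>. combined_grad c x \<bullet> (A x *v combined_grad c x)
      \<le> t * (combined_grad c x \<bullet> (At x *v combined_grad c x))"
  proof eventually_elim
    case (elim x)
    let ?g = "combined_grad c x" and ?e = "eig_max (matrix_inv (At x) ** A x)"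
    show ?case
    proof (cases "?g = 0")
      case False
      then have "?e \<le> t" using elim(2) by blast
      moreover have "?g \<bullet> (A x *v ?g) \<le> ?e * (?g \<bullet> (At x *v ?g))" "0 \<le> ?g \<bullet> (At x *v ?g)"
        using elim(1) by blast+
      ultimately show ?thesis using mult_right_mono[of ?e t "?g \<bullet> (At x *v ?g)"] by linarith
    qed simp
  qed
  then have "(LINT x|lebesgue_on \<Omega>. combined_grad c x \<bullet> (A x *v combined_grad c x))
      \<le> (LINT x|lebesgue_on \<Omega>. t * (combined_grad c x \<bullet> (At x *v combined_grad c x)))"
    by (intro integral_mono_AE integrable_mult_right integrable_combined_energy A At)
  then show ?thesis by (simp add: stiffness_form A At)
qed

lemma stiffness_form_ge:
  assumes "\<And>k. c $ k \<noteq> 0 \<Longrightarrow> ereal t \<le> lambda_L \<Omega> Ne E At A (\<phi> k)"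
  shows "t * (c \<bullet> (stiffness \<Omega> At \<phi> *v c)) \<le> c \<bullet> (stiffness \<Omega> A \<phi> *v c)"
proof -
  have "AE x in lebesgue_on \<Omega>. combined_grad c x = 0 \<or> t \<le> eig_min (matrix_inv (At x) ** A x)"
  proof (rule AE_combined_grad_eq_0_or)
    fix k j assume "c $ k \<noteq> 0" and j: "j \<in> {1..Ne}" "E j \<subseteq> patch \<Omega> Ne E (\<phi> k)"
    then have le: "ereal t \<le> alpha_min At A (E j)"
      using assms lambda_L_le_alpha_min order_trans by blast
    from AE_alpha_min_le_eig_min[where S = "E j" and At = At and A = A]
    show "AE x in lebesgue_on (E j). t \<le> eig_min (matrix_inv (At x) ** A x)"
      by (rule eventually_mono) (metis le ereal_less_eq(3) order_trans)
  qed
  with AE_pointwise_spectral_bounds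
  have "AE x in lebesgue_on \<Omega>. t * (combined_grad c x \<bullet> (At x *v combined_grad c x))
      \<le> combined_grad c x \<bullet> (A x *v combined_grad c x)"
  proof eventually_elim
    case (elim x)
    let ?g = "combined_grad c x" and ?e = "eig_min (matrix_inv (At x) ** A x)"
    show ?case
    proof (cases "?g = 0")
      case False
      then have "t \<le> ?e" using elim(2) by blast
      moreover have "?e * (?g \<bullet> (At x *v ?g)) \<le> ?g \<bullet> (A x *v ?g)" "0 \<le> ?g \<bullet> (At x *v ?g)"
        using elim(1) by blast+
      ultimately show ?thesis using mult_right_mono[of t ?e "?g \<bullet> (At x *v ?g)"] by linarith
    qed simp
  qed
  then have "(LINT x|lebesgue_on \<Omega>. t * (combined_grad c x \<bullet> (At x *v combined_grad c x)))
      \<le> (LINT x|lebesgue_on \<Omega>. combined_grad c x \<bullet> (A x *v combined_grad c x))"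
    by (intro integral_mono_AE integrable_mult_right integrable_combined_energy A At)
  then show ?thesis by (simp add: stiffness_form A At)
qed

end

section \<open>Patch-wise eigenvalue bounds\<close>

lemma polyhedral_domain_props:
  assumes "polyhedral_domain \<Omega>"
  shows "open \<Omega>" "bounded \<Omega>" "connected \<Omega>" "\<Omega> \<noteq> {}" "interior (closure \<Omega>) = \<Omega>"
proof -
  obtain F where F: "finite F" "\<And>P. P \<in> F \<Longrightarrow> polytope P" "\<Omega> = interior (\<Union>F)"
    using assms unfolding polyhedral_domain_def by blast
  show "open \<Omega>" "connected \<Omega>" "\<Omega> \<noteq> {}"
    using F(3) assms unfolding polyhedral_domain_def by auto
  have "bounded (\<Union>F)" using F polytope_imp_bounded by (intro bounded_Union) auto
  then show "bounded \<Omega>" using F(3) bounded_subset interior_subset by blast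
  have "closed (\<Union>F)" using F polytope_imp_closed by (intro closed_Union) auto
  then have "closure \<Omega> \<subseteq> \<Union>F" using F(3) interior_subset by (intro closure_minimal) auto
  then have "interior (closure \<Omega>) \<subseteq> \<Omega>" using F(3) interior_mono by blast
  moreover have "\<Omega> \<subseteq> interior (closure \<Omega>)"
    using \<open>open \<Omega>\<close> closure_subset by (intro interior_maximal)
  ultimately show "interior (closure \<Omega>) = \<Omega>" by blast
qed

context finite_element_setting
begin

abbreviation "SA \<equiv> stiffness \<Omega> A \<phi>"
abbreviation "SAt \<equiv> stiffness \<Omega> At \<phi>"
abbreviation "W \<equiv> orthogonal_comp (null_space SA)"

lemma null_spaces_eq: "null_space SA = null_space SAt"
  by (simp add: null_space_stiffness A At)

lemma stiffness_pos:
  assumes "w \<in> W" "w \<noteq> 0"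
  shows "0 < w \<bullet> (SA *v w)" "0 < w \<bullet> (SAt *v w)"
proof -
  have "w \<notin> null_space SA" using assms null_space_Int_comp[of SA] by blast
  then have "\<not> (AE x in lebesgue_on \<Omega>. combined_grad w x = 0)"
    by (simp add: null_space_stiffness A combined_grad_eq_0_iff_constant)
  then show "0 < w \<bullet> (SA *v w)" "0 < w \<bullet> (SAt *v w)"
    using stiffness_form_eq_0_iff[OF A, of w] stiffness_form_eq_0_iff[OF At, of w] by (auto simp: less_le)
qed

text \<open>The trial space consists of the coefficient vectors supported in \<open>K\<close>. On it the patch bounds of
the members of \<open>K\<close> bound the Rayleigh quotient. They are extended reals, hence the bounds are
compared with every real number in between, which also settles infinite values.\<close>

lemma eigenvalue_bounds:
  assumes basis: "pencil_eigenbasis SA SAt W v \<mu>" and k: "k < dim W"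
  shows "card K + dim W > CARD('n) + k \<Longrightarrow> (\<And>i. i \<in> K \<Longrightarrow> lambda_U \<Omega> Ne E At A (\<phi> i) \<le> u) \<Longrightarrow> ereal (\<mu> k) \<le> u"
    and "card K + k \<ge> CARD('n) \<Longrightarrow> (\<And>i. i \<in> K \<Longrightarrow> l \<le> lambda_L \<Omega> Ne E At A (\<phi> i)) \<Longrightarrow> l \<le> ereal (\<mu> k)"
proof -
  interpret pencil_eigenbasis SA SAt W v \<mu> by (rule basis)
  let ?S = "{c :: real^'n. \<forall>i. i \<notin> K \<longrightarrow> c $ i = 0}"
  have S: "subspace ?S" "dim ?S = card K"
    using dim_substandard_cart[of K, where ?'a = real] by (auto simp: dim_vec_eq subspace_def)
  show "ereal (\<mu> k) \<le> u" if card: "card K + dim W > CARD('n) + k" and u: "\<And>i. i \<in> K \<Longrightarrow> lambda_U \<Omega> Ne E At A (\<phi> i) \<le> u"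
  proof (rule ccontr)
    assume "\<not> ereal (\<mu> k) \<le> u"
    then obtain t where t: "u < ereal t" "t < \<mu> k"
      unfolding not_le using ereal_dense2[of u "ereal (\<mu> k)"] by auto
    have "\<mu> k \<le> t"
    proof (rule eigenvalue_le_if_form_le[OF S(1) k _ stiffness_pos(2)])
      fix c assume "c \<in> ?S"
      then show "c \<bullet> (SA *v c) \<le> t * (c \<bullet> (SAt *v c))"
        using u t(1) by (intro stiffness_form_le) (metis (mono_tags, lifting) less_imp_le mem_Collect_eq order_trans)
    qed (use card S(2) in auto)
    then show False using t by simp
  qed
  show "l \<le> ereal (\<mu> k)" if card: "card K + k \<ge> CARD('n)" and l: "\<And>i. i \<in> K \<Longrightarrow> l \<le> lambda_L \<Omega> Ne E At A (\<phi> i)"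
  proof (rule ccontr)
    assume "\<not> l \<le> ereal (\<mu> k)"
    then obtain t where t: "\<mu> k < t" "ereal t < l"
      unfolding not_le using ereal_dense2[of "ereal (\<mu> k)" l] by auto
    have "t \<le> \<mu> k"
    proof (rule eigenvalue_ge_if_form_ge[OF S(1) k _ stiffness_pos(2)])
      fix c assume "c \<in> ?S"
      then show "t * (c \<bullet> (SAt *v c)) \<le> c \<bullet> (SA *v c)"
        using l t(2) by (intro stiffness_form_ge) (metis (mono_tags, lifting) less_imp_le mem_Collect_eq order_trans)
    qed (use card S(2) in auto)
    then show False using t by simp
  qed
qed

end

theorem mainTheorem3:
  fixes \<Omega> :: "(real^'d) set"
    and A At :: "real^'d \<Rightarrow> real^'d^'d"
    and Ne :: nat and E :: "nat \<Rightarrow> (real^'d) set"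
    and V :: "(real^'d \<Rightarrow> real) set"
    and \<phi> :: "'n::finite \<Rightarrow> real^'d \<Rightarrow> real"
    and r s :: "nat \<Rightarrow> 'n"
  defines "N \<equiv> CARD('n)"
    and "SA \<equiv> stiffness \<Omega> A \<phi>"
    and "SAt \<equiv> stiffness \<Omega> At \<phi>"
    and "lamL \<equiv> \<lambda>k. lambda_L \<Omega> Ne E At A (\<phi> k)"
    and "lamU \<equiv> \<lambda>k. lambda_U \<Omega> Ne E At A (\<phi> k)"
  assumes "CARD('d) \<in> {2, 3}"
    and "polyhedral_domain \<Omega>"
    and "neumann_or_periodic_space \<Omega> V"
    and "diffusion_coefficient \<Omega> A"
    and "diffusion_coefficient \<Omega> At"
    and "is_decomposition \<Omega> Ne E"
    and "\<forall>k. \<phi> k \<in> V"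
    and "lin_indep_on \<Omega> \<phi>"
    and "span_contains_constants_on \<Omega> \<phi>"
    and "bij_betw r {1..N} UNIV"
    and "bij_betw s {1..N} UNIV"
    and "\<forall>i\<in>{1..N}. \<forall>j\<in>{1..N}. i \<le> j \<longrightarrow> lamL (r i) \<le> lamL (r j)"
    and "\<forall>i\<in>{1..N}. \<forall>j\<in>{1..N}. i \<le> j \<longrightarrow> lamU (s i) \<le> lamU (s j)"
  shows "null_space SA = null_space SAt \<and> dim (null_space SA) = 1 \<and>
    length (restricted_eigenvalues SAt SA) = N - 1 \<and>
    (\<forall>k\<in>{2..N}. precond_eigenvalue SAt SA k \<noteq> 0 \<and>
       lamL (r (k - 1)) \<le> ereal (precond_eigenvalue SAt SA k) \<and>
       ereal (precond_eigenvalue SAt SA k) \<le> lamU (s k))"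
proof -
  have "\<phi> k \<in> continuous_H1 \<Omega>" for k
    using \<open>neumann_or_periodic_space \<Omega> V\<close> \<open>\<forall>k. \<phi> k \<in> V\<close>
    unfolding neumann_or_periodic_space_def continuous_H1_periodic_def by blast
  then interpret finite_element_setting \<Omega> \<phi> Ne E A At
    using polyhedral_domain_props[OF \<open>polyhedral_domain \<Omega>\<close>] assms by unfold_locales auto
  have null: "null_space SA = null_space SAt" unfolding SA_def SAt_def by (rule null_spaces_eq)
  have dim1: "dim (null_space SA) = 1"
    unfolding SA_def using dim_constant_combinations assms by (simp add: null_space_stiffness)
  let ?W = "orthogonal_comp (null_space SA)"
  have dimW: "dim ?W = N - 1"
    using dim_orthogonal_comp[OF subspace_null_space, of SA] dim1 by (simp add: N_def)
  obtain v \<mu> where basis: "pencil_eigenbasis SA SAt ?W v \<mu>"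
    using pencil_eigenbasis_exists[of ?W SA SAt] stiffness_symmetric stiffness_pos(2) A At
    unfolding SA_def SAt_def by (metis subspace_orthogonal_comp)
  have list: "restricted_eigenvalues SAt SA = map \<mu> [0..<N - 1]"
    using restricted_eigenvalues_eq[OF null basis] dimW by simp
  have "precond_eigenvalue SAt SA k \<noteq> 0 \<and> lamL (r (k - 1)) \<le> ereal (precond_eigenvalue SAt SA k) \<and>
      ereal (precond_eigenvalue SAt SA k) \<le> lamU (s k)" if k: "k \<in> {2..N}" for k
  proof -
    have i: "k - 2 < dim ?W" using k dimW by auto
    have eig: "precond_eigenvalue SAt SA k = \<mu> (k - 2)"
      using k by (auto simp: precond_eigenvalue_def list)
    have "v (k - 2) \<in> ?W" "v (k - 2) \<bullet> (SAt *v v (k - 2)) = 1"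
      using pencil_eigenbasis.in_W[OF basis i] pencil_eigenbasis.orthonormal[OF basis i i] by auto
    moreover from this have "v (k - 2) \<noteq> 0" by auto
    ultimately have "\<mu> (k - 2) > 0"
      using stiffness_pos(1) pencil_eigenbasis.form_at_basis[OF basis i] unfolding SA_def by metis
    moreover have "lamL (r (k - 1)) \<le> ereal (\<mu> (k - 2))"
    \<comment> \<open>The \<open>N - k + 2\<close> largest lower bounds, starting with number
      \<open>k - 1\<close>, and the eigenvector number \<open>k - 2\<close>, counted from 0,
      together satisfy the dimension count.\<close>
    proof (rule eigenvalue_bounds(2)[OF basis[unfolded SA_def SAt_def] i[unfolded SA_def]])
      have "inj_on r {1..N}" "{k - 1..N} \<subseteq> {1..N}"
        using assms(15) k by (auto simp: bij_betw_def)
      then have "inj_on r {k - 1..N}" by (rule inj_on_subset)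
      then have "card (r ` {k - 1..N}) = N + 1 - (k - 1)" by (simp add: card_image)
      then show "CARD('n) \<le> card (r ` {k - 1..N}) + (k - 2)" using k by (auto simp: N_def)
      show "lamL (r (k - 1)) \<le> lambda_L \<Omega> Ne E At A (\<phi> i)" if "i \<in> r ` {k - 1..N}" for i
        using that assms(17) k unfolding lamL_def by auto
    qed
    moreover have "ereal (\<mu> (k - 2)) \<le> lamU (s k)"
    \<comment> \<open>The \<open>k\<close> smallest upper bounds. The complement of the null
      space has dimension \<open>N - 1\<close>, which is exactly enough.\<close>
    proof (rule eigenvalue_bounds(1)[OF basis[unfolded SA_def SAt_def] i[unfolded SA_def]])
      have "inj_on s {1..N}" "{1..k} \<subseteq> {1..N}"
        using assms(16) k by (auto simp: bij_betw_def)
      then have "inj_on s {1..k}" by (rule inj_on_subset)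
      then have "card (s ` {1..k}) = k" by (simp add: card_image)
      then show "CARD('n) + (k - 2) < card (s ` {1..k}) + dim (orthogonal_comp (null_space (stiffness \<Omega> A \<phi>)))"
        using k dimW by (auto simp: N_def SA_def)
      show "lambda_U \<Omega> Ne E At A (\<phi> i) \<le> lamU (s k)" if "i \<in> s ` {1..k}" for i
        using that assms(18) k unfolding lamU_def by auto
    qed
    ultimately show ?thesis using eig by simp
  qed
  then show ?thesis using null dim1 list by simp
qed

end
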